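(* Consider return routing, i.e. the total picking time $$T=\sum_{i=1}^{M}P_i+\frac{2l}{v}\sum_{i=1}^{k}A_i+\frac{2}{v}w_a(k^+-1).$$ Then $$\mathbb{E}[T]=\mathbb{E}[M]\mathbb{E}[P]+\frac{2lk}{v}\mathbb{E}[A_i]+\frac{2w_a}{v}\big(\mathbb{E}[k^+]-1\big)$$ and $$\begin{aligned}\mathbb{E}[T^2]&=\mathbb{E}[M(M-1)]\mathbb{E}[P]^2+\mathbb{E}[M]\mathbb{E}[P^2]+\frac{4l^2}{v^2}\Big(k\mathbb{E}[A_i^2]+k(k-1)\mathbb{E}[A_iA_j]\Big)\\ &\quad+\frac{4w_a^2}{v^2}\Big(\mathbb{E}[(k^+)^2]-2\mathbb{E}[k^+]+1\Big)+\frac{4lk}{v}\mathbb{E}[P]\,\mathbb{E}[MA_i]\\ &\quad+\frac{4w_a}{v}\mathbb{E}[P]\Big(\mathbb{E}[Mk^+]-\mathbb{E}[M]\Big)+\frac{8w_al}{v^2}\Big(\sum_{i=1}^{k}\mathbb{E}[A_ik^+]-k\,\mathbb{E}[A_i]\Big),\end{aligned}$$ where $\mathbb{E}[A_i]$, $\mathbb{E}[A_i^2]$, $\mathbb{E}[MA_i]$ do not depend on $i$, $\mathbb{E}[A_iA_j]$ (for $i\neq j$; this term is absent if $k=1$) does not depend on the pair, and $$\mathbb{E}[k^+]=k-\sum_{r=0}^{k-1}P_M\Big(\frac rk\Big),\qquad \mathbb{E}[(k^+)^2]=k^2-\sum_{r=0}^{k-1}(2r+1)P_M\Big(\frac rk\Big),$$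 $$\mathbb{E}[Mk^+]=k\mathbb{E}[M]-\sum_{r=0}^{k-1}\frac rk P_M'\Big(\frac rk\Big),$$ $$\mathbb{E}[A_i]=1-\int_0^1P_M\Big(1-\frac1k+\frac xk\Big)dx,\qquad \mathbb{E}[A_i^2]=1-2\int_0^1xP_M\Big(1-\frac1k+\frac xk\Big)dx,$$ $$\mathbb{E}[A_iA_j]=1-2\int_0^1P_M\Big(1-\frac1k+\frac xk\Big)dx+\int_0^1\!\!\int_0^1P_M\Big(1-\frac2k+\frac{x+y}k\Big)dy\,dx,$$ $$\mathbb{E}[MA_i]=\mathbb{E}[M]-k+(k-1)P_M\Big(1-\frac1k\Big)+\int_0^1P_M\Big(1-\frac1k+\frac xk\Big)dx,$$ $$\mathbb{E}[A_ik^+]=k\,\mathbb{E}[A_i]-\sum_{r=i}^{k-1}\Big\{P_M\Big(\frac rk\Big)-\int_0^1P_M\Big(\frac{r-1+x}k\Big)dx\Big\}.$$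
   Context: Model. $k\ge1$ is an integer (number of aisles, numbered $1,\dots,k$); $l>0$ (aisle length), $w_a>0$ (distance between the middles of adjacent aisles), $v>0$ (walking speed) are constants. The order size $M$ is a nonnegative-integer-valued random variable with $\mathbb{E}[M^2]<\infty$ and probability generating function $P_M(x)=\mathbb{E}[x^M]$, $x\in[-1,1]$ (with $0^0=1$); $P_M'$ is its derivative (one-sided at $1$, so $P_M'(1)=\mathbb{E}[M]$). Given $M$, each of the $M$ items is, independently of the others, placed in an aisle uniformly distributed on $\{1,\dots,k\}$ and, independently, at a location uniformly distributed on $[0,1]$ in that aisle (fraction of the aisle length measured from the front cross-aisle). The item picking times $P_1,P_2,\dots$ are i.i.d. copies of a nonnegative random variable $P$ with $\mathbb{E}[P^2]<\infty$, independent of $M$ and of all item locations. $N_i$ is the number of items in aisle $i$. $k^+=\max\{i:N_i>0\}$ (with $k^+=0$ if $M=0$). $A_i$ is the largest location of an item in aisle $i$ ($A_i=0$ if $N_i=0$). *)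

theory Defs
  imports "HOL-Probability.Probability"
begin

text \<open>
  A configuration consists of the order size \<open>M\<close> and, for the item with number \<open>n \<ge> 1\<close>, its aisle
  \<open>X n\<close>, its location \<open>U n\<close> in that aisle and its picking time \<open>P n\<close>. Only the items with
  \<open>1 \<le> n \<le> M \<omega>\<close> belong to the order; \<open>X n\<close> and \<open>U n\<close> are unconstrained, apart from measurability and
  independence of the picking times, for \<open>n > M \<omega>\<close>.
\<close>

definition items_in :: "('a \<Rightarrow> nat) \<Rightarrow> (nat \<Rightarrow> 'a \<Rightarrow> nat) \<Rightarrow> nat \<Rightarrow> 'a \<Rightarrow> nat" where
  "items_in M X i \<omega> = card {n \<in> {1..M \<omega>}. X n \<omega> = i}"

text \<open>Inserting \<open>0\<close> gives the value \<open>0\<close> for an empty order.\<close>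

definition last_aisle :: "nat \<Rightarrow> ('a \<Rightarrow> nat) \<Rightarrow> (nat \<Rightarrow> 'a \<Rightarrow> nat) \<Rightarrow> 'a \<Rightarrow> nat" where
  "last_aisle k M X \<omega> = Max (insert 0 {i \<in> {1..k}. items_in M X i \<omega> > 0})"

definition farthest ::
  "('a \<Rightarrow> nat) \<Rightarrow> (nat \<Rightarrow> 'a \<Rightarrow> nat) \<Rightarrow> (nat \<Rightarrow> 'a \<Rightarrow> real) \<Rightarrow> nat \<Rightarrow> 'a \<Rightarrow> real" where
  "farthest M X U i \<omega> =
     (if items_in M X i \<omega> = 0 then 0 else Max {U n \<omega> |n. n \<in> {1..M \<omega>} \<and> X n \<omega> = i})"

definition return_time ::
  "nat \<Rightarrow> real \<Rightarrow> real \<Rightarrow> real \<Rightarrow> ('a \<Rightarrow> nat) \<Rightarrow> (nat \<Rightarrow> 'a \<Rightarrow> nat) \<Rightarrow> (nat \<Rightarrow> 'a \<Rightarrow> real) \<Rightarrow>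
     (nat \<Rightarrow> 'a \<Rightarrow> real) \<Rightarrow> 'a \<Rightarrow> real" where
  "return_time k l w\<^sub>a v M X U P \<omega> =
     (\<Sum>n=1..M \<omega>. P n \<omega>) + 2 * l / v * (\<Sum>i=1..k. farthest M X U i \<omega>)
       + 2 / v * w\<^sub>a * (real (last_aisle k M X \<omega>) - 1)"

definition pgf :: "'a measure \<Rightarrow> ('a \<Rightarrow> nat) \<Rightarrow> real \<Rightarrow> real" where
  "pgf \<Omega> M x = (LINT \<omega>|\<Omega>. x ^ M \<omega>)"

text \<open>The generating function lives on \<open>[-1, 1]\<close>; its derivative is one-sided at the end points.\<close>

definition pgf_deriv :: "'a measure \<Rightarrow> ('a \<Rightarrow> nat) \<Rightarrow> real \<Rightarrow> real" where
  "pgf_deriv \<Omega> M x = vector_derivative (pgf \<Omega> M) (at x within {-1..1})"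

text \<open>
  The distribution of the items is prescribed conditionally on \<open>M = m\<close>: under the conditional
  probability measure, the \<open>m\<close> pairs (aisle, location) are independent, and each has the product of
  the uniform distributions on \<open>{1..k}\<close> and on \<open>[0, 1]\<close> as its law. The picking times are copies
  of \<open>P\<^sub>0\<close>. That their whole sequence is independent of \<open>M\<close> together with all aisles and locations
  is stated for the generated sigma-algebras, as \<open>indep_var\<close> needs both variables to have the same type.
\<close>

locale order_picking = prob_space \<Omega>
  for \<Omega> :: "'a measure" and k :: nat and M :: "'a \<Rightarrow> nat" and X :: "nat \<Rightarrow> 'a \<Rightarrow> nat"
    and U :: "nat \<Rightarrow> 'a \<Rightarrow> real" and P :: "nat \<Rightarrow> 'a \<Rightarrow> real" and P\<^sub>0 :: "'a \<Rightarrow> real" +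
  assumes order_size: "random_variable (count_space UNIV) M"
    and order_size_square_integrable: "integrable \<Omega> (\<lambda>\<omega>. (real (M \<omega>))\<^sup>2)"
    and aisle: "\<And>n. n \<ge> 1 \<Longrightarrow> random_variable (count_space UNIV) (X n)"
    and location: "\<And>n. n \<ge> 1 \<Longrightarrow> random_variable borel (U n)"
    and items_indep: "\<And>m. prob {\<omega> \<in> space \<Omega>. M \<omega> = m} > 0 \<Longrightarrow>
      prob_space.indep_vars (uniform_measure \<Omega> {\<omega> \<in> space \<Omega>. M \<omega> = m})
        (\<lambda>_. count_space UNIV \<Otimes>\<^sub>M borel) (\<lambda>n \<omega>. (X n \<omega>, U n \<omega>)) {1..m}"
    and item_uniform: "\<And>m n. prob {\<omega> \<in> space \<Omega>. M \<omega> = m} > 0 \<Longrightarrow> n \<in> {1..m} \<Longrightarrow>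
      distr (uniform_measure \<Omega> {\<omega> \<in> space \<Omega>. M \<omega> = m}) (count_space UNIV \<Otimes>\<^sub>M borel)
        (\<lambda>\<omega>. (X n \<omega>, U n \<omega>))
      = measure_pmf (pmf_of_set {1..k}) \<Otimes>\<^sub>M uniform_measure lborel {0..1}"
    and generic_time: "random_variable borel P\<^sub>0"
    and generic_time_nonneg: "AE \<omega> in \<Omega>. P\<^sub>0 \<omega> \<ge> 0"
    and generic_time_square_integrable: "integrable \<Omega> (\<lambda>\<omega>. (P\<^sub>0 \<omega>)\<^sup>2)"
    and times_indep: "indep_vars (\<lambda>_. borel) P {1..}"
    and times_distr: "\<And>n. n \<ge> 1 \<Longrightarrow> distr \<Omega> borel (P n) = distr \<Omega> borel P\<^sub>0"
    and times_indep_order: "indep_set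
      (sets (vimage_algebra (space \<Omega>) (\<lambda>\<omega>. \<lambda>n\<in>{1..}. P n \<omega>) (PiM {1..} (\<lambda>_. borel))))
      (sets (vimage_algebra (space \<Omega>) (\<lambda>\<omega>. (M \<omega>, \<lambda>n\<in>{1..}. (X n \<omega>, U n \<omega>)))
        (count_space UNIV \<Otimes>\<^sub>M PiM {1..} (\<lambda>_. count_space UNIV \<Otimes>\<^sub>M borel))))"

end

theory Submission
  imports Defs
begin

text \<open>
  Given \<open>M = m\<close>, the \<open>m\<close> items are independent and uniform, so they all lie in a given region of
  relative size \<open>s\<close> with probability \<open>s ^ m\<close>; averaging over \<open>M\<close> turns this into \<open>E [h(M) s ^ M]\<close>
  for every weight \<open>h\<close> (\<open>expectation_all_items\<close>). Upper bounds on the last aisle and on farthest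
  locations are conditions of exactly this kind: every item must lie in an admissible aisle and,
  in some aisles, below a threshold. Hence one formula, \<open>joint_law\<close>, determines the joint law of
  \<open>M\<close>, the last aisle \<open>K\<close> and the farthest locations \<open>A i\<close>, and it does not see which aisles carry
  the thresholds, only how many and which thresholds there are.

  All moments are then integrals of tails. For \<open>K\<close>, which takes the values \<open>0, ..., k\<close>, this is a
  finite summation by parts against the events \<open>K \<le> r\<close>; for \<open>A i\<close>, which lies almost surely in
  \<open>[0, 1]\<close>, it is Fubini's theorem for the events \<open>A i \<le> x\<close> (\<open>layer_cake\<close>). With \<open>h = 1\<close> the
  generating function appears at once. With \<open>h(M) = M\<close> one meets \<open>E [M x ^ M]\<close>, which is \<open>x\<close> times
  the derivative of the generating function (\<open>pgf_deriv_times\<close>); for \<open>E [M A i]\<close> the derivative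
  is integrated away again, because \<open>(m + 1) q ^ m\<close> has an elementary antiderivative.

  Finally, the picking times are independent of the order size, aisles and locations together.
  Splitting by the value of \<open>M\<close> gives the Wald identities \<open>wald_square\<close> and \<open>wald_product\<close> for the
  random sum of picking times, and the moments of the total time follow by expanding the square.
\<close>

section \<open>The last aisle and the farthest location as functions of the items\<close>

lemma items_in_pos_iff: "items_in M X i \<omega> > 0 \<longleftrightarrow> (\<exists>n\<in>{1..M \<omega>}. X n \<omega> = i)"
proof -
  have "finite {n \<in> {1..M \<omega>}. X n \<omega> = i}" by simp
  then show ?thesis unfolding items_in_def by (auto simp: card_gt_0_iff)
qed

lemma last_aisle_le_iff:
  "last_aisle k M X \<omega> \<le> r \<longleftrightarrow> (\<forall>n\<in>{1..M \<omega>}. X n \<omega> \<in> {1..k} \<longrightarrow> X n \<omega> \<le> r)"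
  unfolding last_aisle_def items_in_pos_iff by (subst Max_le_iff) auto

lemma last_aisle_le_number: "last_aisle k M X \<omega> \<le> k"
  by (simp add: last_aisle_le_iff)

text \<open>
  Unlike for \<open>x \<ge> 0\<close>, for negative \<open>x\<close> an empty aisle violates the bound, since its farthest
  location is \<open>0\<close> by convention; the second conjunct records this.
\<close>

lemma farthest_le_iff:
  "farthest M X U i \<omega> \<le> x \<longleftrightarrow>
     (\<forall>n\<in>{1..M \<omega>}. X n \<omega> = i \<longrightarrow> U n \<omega> \<le> x) \<and> (0 \<le> x \<or> (\<exists>n\<in>{1..M \<omega>}. X n \<omega> = i))"
proof (cases "\<exists>n\<in>{1..M \<omega>}. X n \<omega> = i")
  case True
  then have "items_in M X i \<omega> \<noteq> 0" using items_in_pos_iff[of M X i \<omega>] by simp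
  moreover have "{U n \<omega> |n. n \<in> {1..M \<omega>} \<and> X n \<omega> = i} \<noteq> {}" using True by auto
  moreover have "finite {U n \<omega> |n. n \<in> {1..M \<omega>} \<and> X n \<omega> = i}" by simp
  ultimately have "farthest M X U i \<omega> \<le> x \<longleftrightarrow> (\<forall>u\<in>{U n \<omega> |n. n \<in> {1..M \<omega>} \<and> X n \<omega> = i}. u \<le> x)"
    unfolding farthest_def by simp
  also have "\<dots> \<longleftrightarrow> (\<forall>n\<in>{1..M \<omega>}. X n \<omega> = i \<longrightarrow> U n \<omega> \<le> x)" by blast
  finally show ?thesis using True by simp
next
  case False
  then have "items_in M X i \<omega> = 0" using items_in_pos_iff[of M X i \<omega>] by simp
  then show ?thesis unfolding farthest_def using False by auto
qed

lemma farthest_empty: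
  assumes "\<not> (\<exists>n\<in>{1..M \<omega>}. X n \<omega> = i)"
  shows "farthest M X U i \<omega> = 0"
  using assms items_in_pos_iff[of M X i \<omega>] unfolding farthest_def by auto

lemma farthest_in:
  assumes "\<And>n. n \<in> {1..M \<omega>} \<Longrightarrow> U n \<omega> \<in> {0..1}"
  shows "farthest M X U i \<omega> \<in> {0..1}"
proof -
  have "farthest M X U i \<omega> \<le> 1"
    using assms by (auto simp: farthest_le_iff)
  moreover have "\<not> farthest M X U i \<omega> < 0"
  proof
    assume *: "farthest M X U i \<omega> < 0"
    then obtain n where "n \<in> {1..M \<omega>}" "X n \<omega> = i"
      using farthest_empty[of M \<omega> X i U] by fastforce
    moreover from this * have "U n \<omega> \<le> farthest M X U i \<omega>"
      using farthest_le_iff[of M X U i \<omega> "farthest M X U i \<omega>"] by simp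
    ultimately show False using assms[of n] * by auto
  qed
  ultimately show ?thesis by simp
qed

lemma farthest_last_aisle_eq_0:
  assumes "last_aisle k M X \<omega> < i" "i \<in> {1..k}"
  shows "farthest M X U i \<omega> = 0"
  using assms last_aisle_le_iff[of k M X \<omega> "last_aisle k M X \<omega>"]
  by (intro farthest_empty) auto

lemma ball_Suc_iff: "(\<forall>n\<in>{1..m}. Q n) \<longleftrightarrow> (\<forall>n. Suc n \<le> m \<longrightarrow> Q (Suc n))"
  by (metis atLeastAtMost_iff One_nat_def Suc_le_D le_simps(3) zero_less_Suc)

lemma bex_Suc_iff: "(\<exists>n\<in>{1..m}. Q n) \<longleftrightarrow> (\<exists>n. Suc n \<le> m \<and> Q (Suc n))"
  using ball_Suc_iff[of m "\<lambda>n. \<not> Q n"] by blast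

text \<open>
  The measurability lemmas are stated for an arbitrary measure \<open>N\<close>, because they serve twice: for
  the underlying probability space, and for the sigma-algebra generated by the order alone, from
  which the picking times are independent.
\<close>

lemma pred_last_aisle_le:
  assumes [measurable]: "M \<in> measurable N (count_space UNIV)"
    and X: "\<And>n. n \<ge> 1 \<Longrightarrow> X n \<in> measurable N (count_space UNIV)"
  shows "Measurable.pred N (\<lambda>\<omega>. last_aisle k M X \<omega> \<le> r)"
proof -
  \<comment> \<open>Only the items from \<open>1\<close> on are random variables, so the quantifier ranges over successors.\<close>
  have [measurable]: "X (Suc n) \<in> measurable N (count_space UNIV)" for n by (rule X) simp
  have "last_aisle k M X \<omega> \<le> r \<longleftrightarrow>
      (\<forall>n. Suc n \<le> M \<omega> \<longrightarrow> X (Suc n) \<omega> \<in> {1..k} \<longrightarrow> X (Suc n) \<omega> \<le> r)" for \<omega>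
    unfolding last_aisle_le_iff ball_Suc_iff ..
  then show ?thesis by simp
qed

lemma borel_measurable_farthest:
  assumes [measurable]: "M \<in> measurable N (count_space UNIV)"
    and X: "\<And>n. n \<ge> 1 \<Longrightarrow> X n \<in> measurable N (count_space UNIV)"
    and U: "\<And>n. n \<ge> 1 \<Longrightarrow> U n \<in> borel_measurable N"
  shows "farthest M X U i \<in> borel_measurable N"
proof (rule borel_measurableI_le)
  fix x :: real
  have [measurable]: "X (Suc n) \<in> measurable N (count_space UNIV)"
    "U (Suc n) \<in> borel_measurable N" for n by (auto intro: X U)
  have "farthest M X U i \<omega> \<le> x \<longleftrightarrow>
      (\<forall>n. Suc n \<le> M \<omega> \<longrightarrow> X (Suc n) \<omega> = i \<longrightarrow> U (Suc n) \<omega> \<le> x) \<and>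
      (0 \<le> x \<or> (\<exists>n. Suc n \<le> M \<omega> \<and> X (Suc n) \<omega> = i))" for \<omega>
    unfolding farthest_le_iff ball_Suc_iff bex_Suc_iff ..
  then show "{\<omega> \<in> space N. farthest M X U i \<omega> \<le> x} \<in> sets N" by simp
qed

text \<open>
  A telescoping sum in which only the indices \<open>r \<ge> j\<close> survive. Read with \<open>j\<close> random, it writes any
  function of \<open>j\<close> as a linear combination of the events \<open>j \<le> r\<close>, whose probabilities are known.
\<close>

lemma summation_by_parts_of_bool:
  fixes f :: "nat \<Rightarrow> real"
  assumes "j \<le> k"
  shows "f j = f k - (\<Sum>r=0..<k. (f (Suc r) - f r) * of_bool (j \<le> r))"
proof -
  have "(\<Sum>r=0..<k. (f (Suc r) - f r) * of_bool (j \<le> r)) = (\<Sum>r=j..<k. f (Suc r) - f r)"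
    using assms by (intro sum.mono_neutral_cong_right) auto
  also have "\<dots> = f k - f j" using assms by (rule sum_Suc_diff')
  finally show ?thesis by simp
qed

lemma borel_measurable_last_aisle:
  assumes "M \<in> measurable N (count_space UNIV)"
    and "\<And>n. n \<ge> 1 \<Longrightarrow> X n \<in> measurable N (count_space UNIV)"
  shows "(\<lambda>\<omega>. real (last_aisle k M X \<omega>)) \<in> borel_measurable N"
proof -
  have [measurable]: "Measurable.pred N (\<lambda>\<omega>. last_aisle k M X \<omega> \<le> r)" for r
    using assms by (rule pred_last_aisle_le)
  have "(\<lambda>\<omega>. real (last_aisle k M X \<omega>)) =
      (\<lambda>\<omega>. real k - (\<Sum>r=0..<k. (real (Suc r) - real r) * of_bool (last_aisle k M X \<omega> \<le> r)))"
    by (intro ext summation_by_parts_of_bool last_aisle_le_number)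
  moreover have "\<dots> \<in> borel_measurable N"
    unfolding of_bool_def by measurable
  ultimately show ?thesis by (simp only:)
qed

section \<open>Splitting expectations by the order size\<close>

text \<open>
  Without an aisle, the uniform distribution on \<open>{1..k}\<close> would not be meaningful.
\<close>

locale order_picking_aisles = order_picking +
  assumes aisles: "k \<ge> 1"
begin

abbreviation "K \<equiv> last_aisle k M X"
abbreviation "A \<equiv> farthest M X U"
definition "item_law = measure_pmf (pmf_of_set {1..k}) \<Otimes>\<^sub>M uniform_measure lborel {0..1::real}"

lemma measurable_M [measurable]: "M \<in> measurable \<Omega> (count_space UNIV)"
  by (rule order_size)

lemma pred_K [measurable]: "Measurable.pred \<Omega> (\<lambda>\<omega>. K \<omega> \<le> r)"
  by (rule pred_last_aisle_le[OF order_size aisle])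

lemma measurable_A [measurable]: "A i \<in> borel_measurable \<Omega>"
  by (rule borel_measurable_farthest[OF order_size aisle location])

lemma measurable_K [measurable]: "(\<lambda>\<omega>. real (K \<omega>)) \<in> borel_measurable \<Omega>"
  by (rule borel_measurable_last_aisle[OF order_size aisle])

lemma sums_single_order_size: "(\<lambda>m. of_bool (M \<omega> = m) * f \<omega>) sums (f \<omega> :: real)"
proof -
  have "(\<lambda>m. of_bool (M \<omega> = m) * f \<omega>) = (\<lambda>m. if m = M \<omega> then f \<omega> else 0)" by auto
  then show ?thesis using sums_single[of "M \<omega>" "\<lambda>_. f \<omega>"] by simp
qed

lemma integrable_of_bool_times [simp]:
  fixes f :: "'a \<Rightarrow> real"
  assumes f: "integrable \<Omega> f" and [measurable]: "Measurable.pred \<Omega> Q"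
  shows "integrable \<Omega> (\<lambda>\<omega>. of_bool (Q \<omega>) * f \<omega>)"
proof (rule Bochner_Integration.integrable_bound[OF f])
  have [measurable]: "f \<in> borel_measurable \<Omega>" using f by (rule borel_measurable_integrable)
  show "(\<lambda>\<omega>. of_bool (Q \<omega>) * f \<omega>) \<in> borel_measurable \<Omega>"
    unfolding of_bool_def by measurable
qed auto

text \<open>
  Dominated convergence for the restrictions of \<open>f\<close> to the events \<open>M < N\<close>.
\<close>

lemma expectation_sums_order_size:
  fixes f :: "'a \<Rightarrow> real"
  assumes f: "integrable \<Omega> f"
  shows "(\<lambda>m. expectation (\<lambda>\<omega>. of_bool (M \<omega> = m) * f \<omega>)) sums expectation f"
proof -
  have i: "integrable \<Omega> (\<lambda>\<omega>. of_bool (M \<omega> = m) * f \<omega>)" for m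
    by (rule integrable_of_bool_times[OF f]) measurable
  have "(\<lambda>N. expectation (\<lambda>\<omega>. \<Sum>m<N. of_bool (M \<omega> = m) * f \<omega>)) \<longlonglongrightarrow> expectation f"
  proof (rule integral_dominated_convergence[where w="\<lambda>\<omega>. norm (f \<omega>)"])
    show "f \<in> borel_measurable \<Omega>" using f by (rule borel_measurable_integrable)
    show "(\<lambda>\<omega>. \<Sum>m<N. of_bool (M \<omega> = m) * f \<omega>) \<in> borel_measurable \<Omega>" for N
      by (intro borel_measurable_sum borel_measurable_integrable[OF i])
    show "integrable \<Omega> (\<lambda>\<omega>. norm (f \<omega>))" using f by (rule integrable_norm)
    show "AE \<omega> in \<Omega>. (\<lambda>N. \<Sum>m<N. of_bool (M \<omega> = m) * f \<omega>) \<longlonglongrightarrow> f \<omega>"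
      using sums_single_order_size by (simp add: sums_def)
    fix N
    have "(\<Sum>m<N. of_bool (M \<omega> = m) * f \<omega>) = (if M \<omega> < N then f \<omega> else 0)" for \<omega>
    proof -
      have "(\<Sum>m<N. of_bool (M \<omega> = m) * f \<omega>) = (\<Sum>m<N. if M \<omega> = m then f \<omega> else 0)"
        by (rule sum.cong) auto
      then show ?thesis by simp
    qed
    then show "AE \<omega> in \<Omega>. norm (\<Sum>m<N. of_bool (M \<omega> = m) * f \<omega>) \<le> norm (f \<omega>)" by simp
  qed
  then show ?thesis unfolding Bochner_Integration.integral_sum[OF i] sums_def .
qed

lemma expectation_eqI_order_size:
  fixes f g :: "'a \<Rightarrow> real"
  assumes "integrable \<Omega> f" "integrable \<Omega> g"
    and "\<And>m. expectation (\<lambda>\<omega>. of_bool (M \<omega> = m) * f \<omega>) = expectation (\<lambda>\<omega>. of_bool (M \<omega> = m) * g \<omega>)"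
  shows "expectation f = expectation g"
  using expectation_sums_order_size[OF assms(1)] expectation_sums_order_size[OF assms(2)]
  unfolding assms(3) by (rule sums_unique2)

text \<open>
  A nonnegative function with the same mean as an integrable one on each event \<open>M = m\<close> is
  integrable. This is how the square of a random sum, for which no bound is available beforehand,
  is seen to have finite expectation.
\<close>

lemma integrable_order_sizeI:
  fixes f g :: "'a \<Rightarrow> real"
  assumes f: "\<And>m. integrable \<Omega> (\<lambda>\<omega>. of_bool (M \<omega> = m) * f \<omega>)" and g: "integrable \<Omega> g"
    and pos: "\<And>\<omega>. f \<omega> \<ge> 0"
    and eq: "\<And>m. expectation (\<lambda>\<omega>. of_bool (M \<omega> = m) * f \<omega>) = expectation (\<lambda>\<omega>. of_bool (M \<omega> = m) * g \<omega>)"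
  shows "integrable \<Omega> f"
proof -
  have n: "norm (of_bool (M \<omega> = m) * f \<omega>) = of_bool (M \<omega> = m) * f \<omega>" for m \<omega>
    using pos by simp
  have "integrable \<Omega> (\<lambda>\<omega>. \<Sum>m. of_bool (M \<omega> = m) * f \<omega>)"
  proof (rule integrable_suminf[OF f])
    show "AE \<omega> in \<Omega>. summable (\<lambda>m. norm (of_bool (M \<omega> = m) * f \<omega>))"
      unfolding n by (intro AE_I2 sums_summable[OF sums_single_order_size])
    show "summable (\<lambda>m. \<integral>\<omega>. norm (of_bool (M \<omega> = m) * f \<omega>) \<partial>\<Omega>)"
      unfolding n eq by (intro sums_summable[OF expectation_sums_order_size[OF g]])
  qed
  moreover have "(\<lambda>\<omega>. \<Sum>m. of_bool (M \<omega> = m) * f \<omega>) = f"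
    by (intro ext sums_unique[symmetric] sums_single_order_size)
  ultimately show ?thesis by simp
qed

section \<open>The joint law of the order size, the last aisle and the farthest locations\<close>

lemma prob_space_item_law: "prob_space item_law"
proof -
  have "prob_space (uniform_measure lborel {0..1::real})"
    by (rule prob_space_uniform_measure) auto
  moreover have "prob_space (measure_pmf (pmf_of_set {1..k}))" by (rule prob_space_measure_pmf)
  ultimately show ?thesis unfolding item_law_def
    by (intro prob_space_pair) auto
qed

lemma sets_item_law: "sets item_law = sets (count_space UNIV \<Otimes>\<^sub>M borel)"
  unfolding item_law_def by (rule sets_pair_measure_cong) auto

lemma pred_item:
  assumes S: "S \<in> sets (count_space UNIV \<Otimes>\<^sub>M borel)" and n: "n \<ge> 1"
  shows "Measurable.pred \<Omega> (\<lambda>\<omega>. (X n \<omega>, U n \<omega>) \<in> S)"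
proof -
  have [measurable]: "X n \<in> measurable \<Omega> (count_space UNIV)" "U n \<in> borel_measurable \<Omega>"
    using n aisle location by auto
  note S[measurable]
  show ?thesis by measurable
qed

lemma pred_all_items:
  assumes S: "S \<in> sets (count_space UNIV \<Otimes>\<^sub>M borel)"
  shows "Measurable.pred \<Omega> (\<lambda>\<omega>. \<forall>n\<in>{1..m}. (X n \<omega>, U n \<omega>) \<in> S)"
    and "Measurable.pred \<Omega> (\<lambda>\<omega>. \<forall>n\<in>{1..M \<omega>}. (X n \<omega>, U n \<omega>) \<in> S)"
proof -
  have [measurable]: "Measurable.pred \<Omega> (\<lambda>\<omega>. (X (Suc n) \<omega>, U (Suc n) \<omega>) \<in> S)" for n
    by (rule pred_item[OF S]) simp
  show "Measurable.pred \<Omega> (\<lambda>\<omega>. \<forall>n\<in>{1..m}. (X n \<omega>, U n \<omega>) \<in> S)"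
    unfolding ball_Suc_iff by measurable
  show "Measurable.pred \<Omega> (\<lambda>\<omega>. \<forall>n\<in>{1..M \<omega>}. (X n \<omega>, U n \<omega>) \<in> S)"
    unfolding ball_Suc_iff by measurable
qed

text \<open>
  The probability factorises under the conditional measure given \<open>M = m\<close>, where the items are
  independent with law \<open>item_law\<close>; values \<open>m\<close> of probability \<open>0\<close>, for which nothing is known about
  the items, contribute \<open>0\<close> to both sides.
\<close>

lemma prob_order_size_all_items:
  assumes S: "S \<in> sets (count_space UNIV \<Otimes>\<^sub>M borel)"
  shows "prob {\<omega> \<in> space \<Omega>. M \<omega> = m \<and> (\<forall>n\<in>{1..m}. (X n \<omega>, U n \<omega>) \<in> S)} =
    prob {\<omega> \<in> space \<Omega>. M \<omega> = m} * measure item_law S ^ m"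
proof (cases "prob {\<omega> \<in> space \<Omega>. M \<omega> = m} > 0")
  case False
  then have 0: "prob {\<omega> \<in> space \<Omega>. M \<omega> = m} = 0"
    by (metis measure_nonneg order_le_imp_less_or_eq)
  have "prob {\<omega> \<in> space \<Omega>. M \<omega> = m \<and> (\<forall>n\<in>{1..m}. (X n \<omega>, U n \<omega>) \<in> S)} \<le> prob {\<omega> \<in> space \<Omega>. M \<omega> = m}"
    by (rule finite_measure_mono) auto
  then show ?thesis using 0 by (simp add: measure_le_0_iff)
next
  case True
  let ?B = "{\<omega> \<in> space \<Omega>. M \<omega> = m}"
  let ?Q = "uniform_measure \<Omega> ?B"
  have B [measurable]: "?B \<in> sets \<Omega>" by simp
  have e: "emeasure \<Omega> ?B \<noteq> 0" "emeasure \<Omega> ?B \<noteq> \<infinity>"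
    using True by (auto simp: emeasure_eq_measure)
  interpret Q: prob_space ?Q using e by (rule prob_space_uniform_measure)
  have Q: "Q.prob C * prob ?B = prob (?B \<inter> C)" if "C \<in> sets \<Omega>" for C
    using that True e by (subst measure_uniform_measure) auto
  let ?C = "{\<omega> \<in> space \<Omega>. \<forall>n\<in>{1..m}. (X n \<omega>, U n \<omega>) \<in> S}"
  have C: "?C \<in> sets \<Omega>"
    using pred_all_items(1)[OF S, of m] by simp
  have "Q.prob ?C = measure item_law S ^ m"
  \<comment> \<open>Independence yields a product only over a nonempty index set.\<close>
  proof (cases "m = 0")
    case True
    have "?C = space ?Q" using True by auto
    then show ?thesis using True Q.prob_space by simp
  next
    case False
    have "?C = (\<Inter>n\<in>{1..m}. (\<lambda>\<omega>. (X n \<omega>, U n \<omega>)) -` S \<inter> space ?Q)"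
      using False by auto
    then have "Q.prob ?C = (\<Prod>n\<in>{1..m}. Q.prob ((\<lambda>\<omega>. (X n \<omega>, U n \<omega>)) -` S \<inter> space ?Q))"
      using Q.indep_varsD[OF items_indep[OF True], of "{1..m}" "\<lambda>_. S"] S False by simp
    also have "\<dots> = (\<Prod>n\<in>{1..m}. measure item_law S)"
    proof (rule prod.cong[OF refl])
      fix n assume n: "n \<in> {1..m}"
      have "(\<lambda>\<omega>. (X n \<omega>, U n \<omega>)) \<in> measurable ?Q (count_space UNIV \<Otimes>\<^sub>M borel)"
        unfolding measurable_cong_sets[OF sets_uniform_measure refl]
        using n aisle[of n] location[of n] by (intro measurable_Pair) auto
      from measure_distr[OF this S]
      show "Q.prob ((\<lambda>\<omega>. (X n \<omega>, U n \<omega>)) -` S \<inter> space ?Q) = measure item_law S"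
        unfolding item_uniform[OF True n] item_law_def by simp
    qed
    finally show ?thesis by simp
  qed
  moreover have "?B \<inter> ?C = {\<omega> \<in> space \<Omega>. M \<omega> = m \<and> (\<forall>n\<in>{1..m}. (X n \<omega>, U n \<omega>) \<in> S)}" by auto
  ultimately show ?thesis using Q[OF C] by (simp add: mult.commute)
qed

lemma borel_measurable_order_size: "(\<lambda>\<omega>. (g (M \<omega>) :: real)) \<in> borel_measurable \<Omega>"
  by measurable

lemma integrable_order_size_power:
  fixes h :: "nat \<Rightarrow> real"
  assumes h: "integrable \<Omega> (\<lambda>\<omega>. h (M \<omega>))" and s: "\<bar>s\<bar> \<le> 1"
  shows "integrable \<Omega> (\<lambda>\<omega>. h (M \<omega>) * s ^ M \<omega>)"
proof (rule Bochner_Integration.integrable_bound[OF h])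
  show "AE \<omega> in \<Omega>. norm (h (M \<omega>) * s ^ M \<omega>) \<le> norm (h (M \<omega>))"
    using s by (intro AE_I2) (simp add: abs_mult power_abs mult_left_le power_le_one)
qed (rule borel_measurable_order_size)

text \<open>
  The source of all formulas: a condition imposed on every item separately acts on a weight
  depending on the order size like the factor \<open>s ^ M\<close>, with \<open>s\<close> the probability that a single item
  satisfies it.
\<close>

lemma expectation_all_items:
  fixes h :: "nat \<Rightarrow> real"
  assumes S: "S \<in> sets (count_space UNIV \<Otimes>\<^sub>M borel)"
    and h: "integrable \<Omega> (\<lambda>\<omega>. h (M \<omega>))"
  shows "expectation (\<lambda>\<omega>. of_bool (\<forall>n\<in>{1..M \<omega>}. (X n \<omega>, U n \<omega>) \<in> S) * h (M \<omega>)) =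
    expectation (\<lambda>\<omega>. h (M \<omega>) * measure item_law S ^ M \<omega>)"
proof (rule expectation_eqI_order_size)
  interpret I: prob_space item_law by (rule prob_space_item_law)
  show "integrable \<Omega> (\<lambda>\<omega>. of_bool (\<forall>n\<in>{1..M \<omega>}. (X n \<omega>, U n \<omega>) \<in> S) * h (M \<omega>))"
    by (rule integrable_of_bool_times[OF h pred_all_items(2)[OF S]])
  show "integrable \<Omega> (\<lambda>\<omega>. h (M \<omega>) * measure item_law S ^ M \<omega>)"
    by (rule integrable_order_size_power[OF h]) simp
  fix m
  let ?C = "{\<omega> \<in> space \<Omega>. M \<omega> = m \<and> (\<forall>n\<in>{1..m}. (X n \<omega>, U n \<omega>) \<in> S)}"
  let ?B = "{\<omega> \<in> space \<Omega>. M \<omega> = m}"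
  have [measurable]: "Measurable.pred \<Omega> (\<lambda>\<omega>. \<forall>n\<in>{1..m}. (X n \<omega>, U n \<omega>) \<in> S)"
    by (rule pred_all_items(1)[OF S])
  have C [measurable]: "?C \<in> sets \<Omega>" and B [measurable]: "?B \<in> sets \<Omega>" by measurable
  have "expectation (\<lambda>\<omega>. of_bool (M \<omega> = m) *
      (of_bool (\<forall>n\<in>{1..M \<omega>}. (X n \<omega>, U n \<omega>) \<in> S) * h (M \<omega>))) = expectation (\<lambda>\<omega>. h m * indicator ?C \<omega>)"
    by (rule Bochner_Integration.integral_cong[OF refl]) (auto simp: indicator_def)
  also have "\<dots> = h m * measure item_law S ^ m * prob ?B"
    using C by (simp add: prob_order_size_all_items[OF S] mult_ac del: One_nat_def)
  also have "\<dots> = expectation (\<lambda>\<omega>. (h m * measure item_law S ^ m) * indicator ?B \<omega>)"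
    using B by simp
  also have "\<dots> = expectation (\<lambda>\<omega>. of_bool (M \<omega> = m) * (h (M \<omega>) * measure item_law S ^ M \<omega>))"
    by (rule Bochner_Integration.integral_cong[OF refl]) (auto simp: indicator_def)
  finally show "expectation (\<lambda>\<omega>. of_bool (M \<omega> = m) *
      (of_bool (\<forall>n\<in>{1..M \<omega>}. (X n \<omega>, U n \<omega>) \<in> S) * h (M \<omega>))) =
    expectation (\<lambda>\<omega>. of_bool (M \<omega> = m) * (h (M \<omega>) * measure item_law S ^ M \<omega>))" .
qed

lemma measure_item_law:
  assumes S: "S \<in> sets (count_space UNIV \<Otimes>\<^sub>M borel)"
  shows "measure item_law S = (\<Sum>a=1..k. measure (uniform_measure lborel {0..1::real}) (Pair a -` S)) / k"
proof -
  let ?U = "uniform_measure lborel {0..1::real}"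
  interpret V: prob_space ?U by (rule prob_space_uniform_measure) auto
  have "emeasure item_law S = (\<integral>\<^sup>+a. emeasure ?U (Pair a -` S) \<partial>measure_pmf (pmf_of_set {1..k}))"
    unfolding item_law_def using S
    by (intro V.emeasure_pair_measure_alt) (auto simp: sets_item_law[unfolded item_law_def])
  also have "\<dots> = (\<Sum>a\<in>{1..k}. ennreal (V.prob (Pair a -` S)) * ennreal (pmf (pmf_of_set {1..k}) a))"
    unfolding V.emeasure_eq_measure using aisles
    by (subst nn_integral_measure_pmf_support[of "{1..k}"]) (auto simp: ennreal_mult'')
  also have "\<dots> = ennreal (\<Sum>a\<in>{1..k}. V.prob (Pair a -` S) * pmf (pmf_of_set {1..k}) a)"
    by (subst sum_ennreal[symmetric]) (auto simp: ennreal_mult simp del: pmf_of_set)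
  also have "(\<Sum>a\<in>{1..k}. V.prob (Pair a -` S) * pmf (pmf_of_set {1..k}) a) =
      (\<Sum>a=1..k. V.prob (Pair a -` S)) / k"
    using aisles unfolding sum_divide_distrib by (intro sum.cong refl) (auto simp: pmf_of_set)
  finally show ?thesis
    by (simp add: measure_def sum_nonneg)
qed

text \<open>
  Here the region has full measure, so that \<open>s = 1\<close>.
\<close>

lemma AE_items_in_unit_interval: "AE \<omega> in \<Omega>. \<forall>n\<in>{1..M \<omega>}. U n \<omega> \<in> {0..1}"
proof -
  let ?S = "{p \<in> space (count_space (UNIV :: nat set) \<Otimes>\<^sub>M borel). snd p \<in> {0..1::real}}"
  let ?Q = "\<lambda>\<omega>. \<forall>n\<in>{1..M \<omega>}. (X n \<omega>, U n \<omega>) \<in> ?S"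
  have S: "?S \<in> sets (count_space UNIV \<Otimes>\<^sub>M borel)" by measurable
  have [measurable]: "Measurable.pred \<Omega> ?Q" by (rule pred_all_items(2)[OF S])
  have "Pair a -` ?S = {0..1}" for a :: nat by (auto simp: space_pair_measure)
  then have "measure item_law ?S = (\<Sum>a=1..k. measure (uniform_measure lborel {0..1::real}) {0..1}) / k"
    unfolding measure_item_law[OF S] by (simp only:)
  then have "measure item_law ?S = 1" using aisles by simp
  then have "expectation (\<lambda>\<omega>. of_bool (?Q \<omega>) * (1::real)) = 1"
    using expectation_all_items[OF S, of "\<lambda>_. 1"] prob_space by simp
  moreover have "expectation (\<lambda>\<omega>. of_bool (?Q \<omega>) * (1::real)) = expectation (indicator {\<omega> \<in> space \<Omega>. ?Q \<omega>})"
    by (rule Bochner_Integration.integral_cong[OF refl]) (auto simp: indicator_def)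
  moreover have "{\<omega> \<in> space \<Omega>. ?Q \<omega>} \<in> sets \<Omega>" by measurable
  ultimately have "prob {\<omega> \<in> space \<Omega>. ?Q \<omega>} = 1" by simp
  then have "AE \<omega> in \<Omega>. ?Q \<omega>"
    using \<open>{\<omega> \<in> space \<Omega>. ?Q \<omega>} \<in> sets \<Omega>\<close> by (subst (asm) prob_Collect_eq_1) auto
  then show ?thesis by eventually_elim auto
qed

lemma AE_farthest: "AE \<omega> in \<Omega>. A i \<omega> \<in> {0..1}"
  using AE_items_in_unit_interval by eventually_elim (rule farthest_in, blast)

lemma measure_uniform_unit_interval_atMost:
  assumes "0 \<le> t" "t \<le> 1"
  shows "measure (uniform_measure lborel {0..1::real}) {..t} = t"
proof -
  have "{0..1} \<inter> {..t} = {0..t}" using assms by auto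
  then show ?thesis using assms by (simp add: measure_uniform_measure)
qed

text \<open>
  The admissible region is a union of aisles: nothing of an aisle beyond \<open>r\<close>, the part \<open>[0, t j]\<close>
  of an aisle \<open>j \<in> J\<close>, and the whole of every other aisle. Starting from \<open>r\<close> full aisles, each
  threshold removes length \<open>1 - t j\<close>.
\<close>

lemma joint_law:
  fixes h :: "nat \<Rightarrow> real" and t :: "nat \<Rightarrow> real"
  assumes h: "integrable \<Omega> (\<lambda>\<omega>. h (M \<omega>))"
    and r: "r \<le> k" and J: "J \<subseteq> {1..r}" and t: "\<And>j. j \<in> J \<Longrightarrow> t j \<in> {0..1}"
  shows "expectation (\<lambda>\<omega>. of_bool (K \<omega> \<le> r \<and> (\<forall>j\<in>J. A j \<omega> \<le> t j)) * h (M \<omega>)) =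
    expectation (\<lambda>\<omega>. h (M \<omega>) * ((real r - (\<Sum>j\<in>J. 1 - t j)) / k) ^ M \<omega>)"
proof -
  let ?U = "uniform_measure lborel {0..1::real}"
  let ?B = "\<lambda>a. if a \<in> {1..k} \<and> a > r then {} else if a \<in> J then {..t a} else UNIV"
  let ?S = "Sigma UNIV ?B"
  interpret V: prob_space ?U by (rule prob_space_uniform_measure) auto
  have "?S = (\<Union>a. {a} \<times> ?B a)" by auto
  also have "\<dots> \<in> sets (count_space UNIV \<Otimes>\<^sub>M borel)"
    by (intro sets.countable_UN subsetI) (auto intro!: pair_measureI)
  finally have S: "?S \<in> sets (count_space UNIV \<Otimes>\<^sub>M borel)" .
  have eq: "(K \<omega> \<le> r \<and> (\<forall>j\<in>J. A j \<omega> \<le> t j)) \<longleftrightarrow> (\<forall>n\<in>{1..M \<omega>}. (X n \<omega>, U n \<omega>) \<in> ?S)" for \<omega>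
  proof -
    have J': "a \<le> r" if "a \<in> J" for a using J that by auto
    have "(\<forall>j\<in>J. A j \<omega> \<le> t j) \<longleftrightarrow> (\<forall>n\<in>{1..M \<omega>}. X n \<omega> \<in> J \<longrightarrow> U n \<omega> \<le> t (X n \<omega>))"
      using t unfolding farthest_le_iff by auto
    moreover have "(X n \<omega>, U n \<omega>) \<in> ?S \<longleftrightarrow>
        (X n \<omega> \<in> {1..k} \<longrightarrow> X n \<omega> \<le> r) \<and> (X n \<omega> \<in> J \<longrightarrow> U n \<omega> \<le> t (X n \<omega>))" for n
      using J'[of "X n \<omega>"] by auto
    ultimately show ?thesis unfolding last_aisle_le_iff by blast
  qed
  have "measure ?U (Pair a -` ?S) = (if a \<in> {1..r} then 1 - (if a \<in> J then 1 - t a else 0) else 0)"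
    if "a \<in> {1..k}" for a
  proof -
    have "Pair a -` ?S = ?B a" by auto
    moreover have "a \<in> {1..r}" if "a \<in> J" using that J by auto
    ultimately show ?thesis
      using that t[of a] V.prob_space by (auto simp: measure_uniform_unit_interval_atMost)
  qed
  then have "(\<Sum>a=1..k. measure ?U (Pair a -` ?S)) =
      (\<Sum>a=1..k. if a \<in> {1..r} then 1 - (if a \<in> J then 1 - t a else 0) else 0)"
    by (rule sum.cong[OF refl])
  also have "\<dots> = (\<Sum>a=1..r. 1 - (if a \<in> J then 1 - t a else 0))"
    using r by (intro sum.mono_neutral_cong_right) auto
  also have "\<dots> = real r - (\<Sum>a=1..r. if a \<in> J then 1 - t a else 0)"
    by (simp add: sum_subtractf)
  also have "(\<Sum>a=1..r. if a \<in> J then 1 - t a else 0) = (\<Sum>j\<in>J. 1 - t j)"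
    using J by (intro sum.mono_neutral_cong_right) auto
  finally show ?thesis
    unfolding eq expectation_all_items[OF S h] measure_item_law[OF S] by (simp only:)
qed

section \<open>Tail integration\<close>

text \<open>
  Fubini's theorem, with a dominating function of product form \<open>Z \<omega> * g x\<close>.
\<close>

lemma expectation_swap_LBINT:
  fixes Z :: "'a \<Rightarrow> real" and g :: "real \<Rightarrow> real" and q :: "'a \<Rightarrow> real \<Rightarrow> real"
  assumes Z: "integrable \<Omega> Z" and g: "set_integrable lborel {0..1} g"
    and q [measurable]: "case_prod q \<in> borel_measurable (\<Omega> \<Otimes>\<^sub>M lborel)"
    and bound: "\<And>\<omega> x. x \<in> {0..1} \<Longrightarrow> \<bar>q \<omega> x\<bar> \<le> 1"
  shows "expectation (\<lambda>\<omega>. Z \<omega> * (LBINT x:{0..1}. g x * q \<omega> x)) =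
    (LBINT x:{0..1}. g x * expectation (\<lambda>\<omega>. q \<omega> x * Z \<omega>))"
proof -
  interpret pair_sigma_finite \<Omega> lborel by unfold_locales
  define G where "G x = indicator {0..1} x * g x" for x :: real
  have G: "integrable lborel G" using g unfolding set_integrable_def G_def by simp
  have [measurable]: "Z \<in> borel_measurable \<Omega>" "G \<in> borel_measurable lborel"
    using Z G by (auto dest: borel_measurable_integrable)
  have prod: "integrable (\<Omega> \<Otimes>\<^sub>M lborel) (\<lambda>p. Z (fst p) * G (snd p))"
  proof (rule Fubini_integrable)
    have "(\<lambda>\<omega>. \<integral>x. norm (Z (fst (\<omega>, x)) * G (snd (\<omega>, x))) \<partial>lborel) =
        (\<lambda>\<omega>. norm (Z \<omega>) * (\<integral>x. norm (G x) \<partial>lborel))"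
      by (simp add: abs_mult)
    then show "integrable \<Omega> (\<lambda>\<omega>. \<integral>x. norm (Z (fst (\<omega>, x)) * G (snd (\<omega>, x))) \<partial>lborel)"
      using Z by simp
  qed (use G in auto)
  have "integrable (\<Omega> \<Otimes>\<^sub>M lborel) (\<lambda>(\<omega>, x). Z \<omega> * G x * q \<omega> x)"
  proof (rule Bochner_Integration.integrable_bound[OF prod])
    have "norm (Z \<omega> * G x * q \<omega> x) \<le> norm (Z \<omega> * G x)" for \<omega> x
      using bound[of x \<omega>] by (cases "x \<in> {0..1}") (auto simp: G_def abs_mult mult_left_le)
    then show "AE p in \<Omega> \<Otimes>\<^sub>M lborel. norm (case p of (\<omega>, x) \<Rightarrow> Z \<omega> * G x * q \<omega> x) \<le> norm (Z (fst p) * G (snd p))"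
      by auto
  qed measurable
  from Fubini_integral[OF this]
  have "(\<integral>x. G x * expectation (\<lambda>\<omega>. q \<omega> x * Z \<omega>) \<partial>lborel) = expectation (\<lambda>\<omega>. Z \<omega> * (\<integral>x. G x * q \<omega> x \<partial>lborel))"
    by (simp add: mult_ac flip: integral_mult_right_zero)
  then show ?thesis
    unfolding set_lebesgue_integral_def G_def by (simp add: mult.assoc)
qed

text \<open>
  Pointwise, \<open>W 1 - W b\<close> is the integral of \<open>w\<close> over \<open>[b, 1]\<close>, that is, of \<open>w x\<close> over those \<open>x\<close>
  in \<open>[0, 1]\<close> with \<open>b \<le> x\<close>. Exchanging the integrals leaves only the events \<open>B \<le> x\<close>.
\<close>

lemma layer_cake:
  fixes Z B :: "'a \<Rightarrow> real" and W w :: "real \<Rightarrow> real"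
  assumes Z: "integrable \<Omega> Z" and [measurable]: "B \<in> borel_measurable \<Omega>"
    and B: "AE \<omega> in \<Omega>. B \<omega> \<in> {0..1}"
    and W: "\<And>x. (W has_real_derivative w x) (at x)" and w: "continuous_on UNIV w"
  shows "expectation (\<lambda>\<omega>. Z \<omega> * (W 1 - W (B \<omega>))) =
    (LBINT x:{0..1}. w x * expectation (\<lambda>\<omega>. of_bool (B \<omega> \<le> x) * Z \<omega>))"
proof -
  have [measurable]: "Z \<in> borel_measurable \<Omega>" using Z by (rule borel_measurable_integrable)
  have [measurable]: "W \<in> borel_measurable borel" "w \<in> borel_measurable borel"
    using W w by (auto intro!: borel_measurable_continuous_onI continuous_at_imp_continuous_on
      dest: DERIV_isCont)
  have FTC: "(LBINT x:{0..1}. w x * of_bool (b \<le> x)) = W 1 - W b" if "b \<in> {0..1}" for b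
  proof -
    have "(LBINT x:{0..1}. w x * of_bool (b \<le> x)) = (\<integral>x. indicator {b..1} x *\<^sub>R w x \<partial>lborel)"
      unfolding set_lebesgue_integral_def
      by (rule Bochner_Integration.integral_cong) (use that in \<open>auto simp: indicator_def\<close>)
    also have "\<dots> = W 1 - W b"
      using that W continuous_on_subset[OF w]
      by (intro integral_FTC_atLeastAtMost)
        (auto simp: has_real_derivative_iff_has_vector_derivative[symmetric] intro: DERIV_subset)
    finally show ?thesis .
  qed
  have "expectation (\<lambda>\<omega>. Z \<omega> * (W 1 - W (B \<omega>))) =
      expectation (\<lambda>\<omega>. Z \<omega> * (LBINT x:{0..1}. w x * of_bool (B \<omega> \<le> x)))"
  proof (rule integral_cong_AE)
    show "(\<lambda>\<omega>. Z \<omega> * (LBINT x:{0..1}. w x * of_bool (B \<omega> \<le> x))) \<in> borel_measurable \<Omega>"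
      unfolding set_lebesgue_integral_def of_bool_def by measurable
    show "AE \<omega> in \<Omega>. Z \<omega> * (W 1 - W (B \<omega>)) = Z \<omega> * (LBINT x:{0..1}. w x * of_bool (B \<omega> \<le> x))"
      using B by eventually_elim (simp add: FTC)
  qed measurable
  also have "\<dots> = (LBINT x:{0..1}. w x * expectation (\<lambda>\<omega>. of_bool (B \<omega> \<le> x) * Z \<omega>))"
  proof (rule expectation_swap_LBINT[OF Z])
    show "set_integrable lborel {0..1} w"
      using continuous_on_subset[OF w] by (intro borel_integrable_atLeastAtMost') auto
    show "case_prod (\<lambda>\<omega> x. of_bool (B \<omega> \<le> x)) \<in> borel_measurable (\<Omega> \<Otimes>\<^sub>M lborel)"
      unfolding of_bool_def by measurable
  qed simp
  finally show ?thesis .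
qed

section \<open>Moments of the last aisle and of the farthest locations\<close>

abbreviation "G \<equiv> pgf \<Omega> M"

lemma integrable_M: "integrable \<Omega> (\<lambda>\<omega>. real (M \<omega>))"
  by (rule square_integrable_imp_integrable[OF _ order_size_square_integrable]) simp

lemma pgf_sums:
  assumes "\<bar>x\<bar> \<le> 1"
  shows "(\<lambda>m. prob {\<omega> \<in> space \<Omega>. M \<omega> = m} * x ^ m) sums G x"
proof -
  have "integrable \<Omega> (\<lambda>\<omega>. x ^ M \<omega>)"
    using integrable_order_size_power[of "\<lambda>_. 1" x] assms by simp
  from expectation_sums_order_size[OF this]
  have "(\<lambda>m. expectation (\<lambda>\<omega>. of_bool (M \<omega> = m) * x ^ M \<omega>)) sums G x" unfolding pgf_def .
  moreover have "expectation (\<lambda>\<omega>. of_bool (M \<omega> = m) * x ^ M \<omega>) = prob {\<omega> \<in> space \<Omega>. M \<omega> = m} * x ^ m" for m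
  proof -
    have "expectation (\<lambda>\<omega>. of_bool (M \<omega> = m) * x ^ M \<omega>) =
        expectation (\<lambda>\<omega>. x ^ m * indicator {\<omega> \<in> space \<Omega>. M \<omega> = m} \<omega>)"
      by (rule Bochner_Integration.integral_cong) (auto simp: indicator_def)
    then show ?thesis by simp
  qed
  ultimately show ?thesis by simp
qed

text \<open>
  Inside the unit interval the generating function is a power series and may be differentiated
  term by term. The factor \<open>x\<close> restores the exponent lowered by differentiation.
\<close>

lemma pgf_deriv_times:
  assumes x: "\<bar>x\<bar> < 1"
  shows "x * pgf_deriv \<Omega> M x = expectation (\<lambda>\<omega>. real (M \<omega>) * x ^ M \<omega>)"
proof -
  let ?p = "\<lambda>m. prob {\<omega> \<in> space \<Omega>. M \<omega> = m}"
  let ?D = "\<Sum>m. diffs ?p m * x ^ m"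
  have sm: "summable (\<lambda>m. ?p m * 1 ^ m)" using pgf_sums[of 1] by (auto intro: sums_summable)
  have "((\<lambda>x. \<Sum>m. ?p m * x ^ m) has_field_derivative ?D) (at x)"
    by (rule termdiffs_strong[OF sm]) (use x in simp)
  then have "(G has_field_derivative ?D) (at x)"
  proof (rule has_field_derivative_transform_within_open)
    show "open {-1<..<1::real}" by simp
    show "x \<in> {-1<..<1}" using x by auto
    fix y :: real assume "y \<in> {-1<..<1}"
    then show "(\<Sum>m. ?p m * y ^ m) = G y" by (intro sums_unique[symmetric] pgf_sums) auto
  qed
  then have "(G has_vector_derivative ?D) (at x within {-1..1})"
    unfolding has_real_derivative_iff_has_vector_derivative by (rule has_vector_derivative_at_within)
  then have D: "pgf_deriv \<Omega> M x = ?D"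
    unfolding pgf_deriv_def using x by (intro vector_derivative_within_closed_interval) auto
  have "summable (\<lambda>m. diffs ?p m * x ^ m)"
    by (rule termdiff_converges[of x 1])
      (use x in \<open>auto intro!: sums_summable[OF pgf_sums]\<close>)
  from sums_mult[OF diffs_equiv[OF this], of x]
  have 1: "(\<lambda>m. x * (of_nat m * ?p m * x ^ (m - Suc 0))) sums (x * ?D)" .
  have "(\<lambda>m. expectation (\<lambda>\<omega>. of_bool (M \<omega> = m) * (real (M \<omega>) * x ^ M \<omega>))) sums
      expectation (\<lambda>\<omega>. real (M \<omega>) * x ^ M \<omega>)"
    by (intro expectation_sums_order_size integrable_order_size_power[OF integrable_M]) (use x in simp)
  moreover have "expectation (\<lambda>\<omega>. of_bool (M \<omega> = m) * (real (M \<omega>) * x ^ M \<omega>)) =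
      x * (of_nat m * ?p m * x ^ (m - Suc 0))" for m
  proof -
    have "expectation (\<lambda>\<omega>. of_bool (M \<omega> = m) * (real (M \<omega>) * x ^ M \<omega>)) =
        expectation (\<lambda>\<omega>. (real m * x ^ m) * indicator {\<omega> \<in> space \<Omega>. M \<omega> = m} \<omega>)"
      by (rule Bochner_Integration.integral_cong) (auto simp: indicator_def)
    then show ?thesis by (cases m) auto
  qed
  ultimately have "(\<lambda>m. x * (of_nat m * ?p m * x ^ (m - Suc 0))) sums
      expectation (\<lambda>\<omega>. real (M \<omega>) * x ^ M \<omega>)" by simp
  with 1 show ?thesis unfolding D by (rule sums_unique2)
qed

lemma expectation_last_aisle:
  fixes f h :: "nat \<Rightarrow> real"
  assumes h: "integrable \<Omega> (\<lambda>\<omega>. h (M \<omega>))"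
  shows "expectation (\<lambda>\<omega>. h (M \<omega>) * f (K \<omega>)) = f k * expectation (\<lambda>\<omega>. h (M \<omega>)) -
      (\<Sum>r=0..<k. (f (Suc r) - f r) * expectation (\<lambda>\<omega>. h (M \<omega>) * (real r / k) ^ M \<omega>))"
proof -
  have eq: "h (M \<omega>) * f (K \<omega>) = f k * h (M \<omega>) -
      (\<Sum>r=0..<k. (f (Suc r) - f r) * (of_bool (K \<omega> \<le> r) * h (M \<omega>)))" for \<omega>
    by (subst summation_by_parts_of_bool[OF last_aisle_le_number])
      (simp add: algebra_simps sum_distrib_left)
  have i: "integrable \<Omega> (\<lambda>\<omega>. of_bool (K \<omega> \<le> r) * h (M \<omega>))" for r
    by (rule integrable_of_bool_times[OF h]) measurable
  have "expectation (\<lambda>\<omega>. h (M \<omega>) * f (K \<omega>)) = f k * expectation (\<lambda>\<omega>. h (M \<omega>)) -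
      (\<Sum>r=0..<k. (f (Suc r) - f r) * expectation (\<lambda>\<omega>. of_bool (K \<omega> \<le> r) * h (M \<omega>)))"
    unfolding eq by (subst Bochner_Integration.integral_diff Bochner_Integration.integral_sum
      integral_mult_right_zero; (intro Bochner_Integration.integrable_sum integrable_mult_right h i)?)+ simp
  also have "(\<Sum>r=0..<k. (f (Suc r) - f r) * expectation (\<lambda>\<omega>. of_bool (K \<omega> \<le> r) * h (M \<omega>))) =
      (\<Sum>r=0..<k. (f (Suc r) - f r) * expectation (\<lambda>\<omega>. h (M \<omega>) * (real r / k) ^ M \<omega>))"
  proof (intro sum.cong refl arg_cong2[where f="(*)"])
    fix r assume "r \<in> {0..<k}"
    then show "expectation (\<lambda>\<omega>. of_bool (K \<omega> \<le> r) * h (M \<omega>)) = expectation (\<lambda>\<omega>. h (M \<omega>) * (real r / k) ^ M \<omega>)"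
      using joint_law[OF h, of r "{}"] by simp
  qed
  finally show "expectation (\<lambda>\<omega>. h (M \<omega>) * f (K \<omega>)) = f k * expectation (\<lambda>\<omega>. h (M \<omega>)) -
      (\<Sum>r=0..<k. (f (Suc r) - f r) * expectation (\<lambda>\<omega>. h (M \<omega>) * (real r / k) ^ M \<omega>))" .
qed

text \<open>
  The common form of the moments of a single farthest location: \<open>W x = x\<close> and \<open>W x = x\<^sup>2\<close> give the
  first and second moment, \<open>h\<close> the mixed moments with the order size, and \<open>r < k\<close> those with the
  last aisle.
\<close>

lemma expectation_farthest:
  fixes h :: "nat \<Rightarrow> real" and W w :: "real \<Rightarrow> real"
  assumes h: "integrable \<Omega> (\<lambda>\<omega>. h (M \<omega>))" and r: "r \<le> k" and i: "i \<in> {1..r}"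
    and W: "\<And>x. (W has_real_derivative w x) (at x)" and w: "continuous_on UNIV w"
  shows "expectation (\<lambda>\<omega>. of_bool (K \<omega> \<le> r) * h (M \<omega>) * (W 1 - W (A i \<omega>))) =
    (LBINT x:{0..1}. w x * expectation (\<lambda>\<omega>. h (M \<omega>) * ((real r - 1 + x) / k) ^ M \<omega>))"
proof -
  have Z: "integrable \<Omega> (\<lambda>\<omega>. of_bool (K \<omega> \<le> r) * h (M \<omega>))"
    by (rule integrable_of_bool_times[OF h]) measurable
  have "expectation (\<lambda>\<omega>. of_bool (K \<omega> \<le> r) * h (M \<omega>) * (W 1 - W (A i \<omega>))) =
      (LBINT x:{0..1}. w x * expectation (\<lambda>\<omega>. of_bool (A i \<omega> \<le> x) * (of_bool (K \<omega> \<le> r) * h (M \<omega>))))"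
    by (rule layer_cake[OF Z measurable_A AE_farthest W w])
  also have "\<dots> = (LBINT x:{0..1}. w x * expectation (\<lambda>\<omega>. h (M \<omega>) * ((real r - 1 + x) / k) ^ M \<omega>))"
  proof (intro set_lebesgue_integral_cong allI impI arg_cong2[where f="(*)"] refl)
    fix x :: real assume x: "x \<in> {0..1}"
    have "expectation (\<lambda>\<omega>. of_bool (A i \<omega> \<le> x) * (of_bool (K \<omega> \<le> r) * h (M \<omega>))) =
        expectation (\<lambda>\<omega>. of_bool (K \<omega> \<le> r \<and> (\<forall>j\<in>{i}. A j \<omega> \<le> x)) * h (M \<omega>))"
      by (rule Bochner_Integration.integral_cong) auto
    also have "\<dots> = expectation (\<lambda>\<omega>. h (M \<omega>) * ((real r - (\<Sum>j\<in>{i}. 1 - x)) / k) ^ M \<omega>)"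
      by (rule joint_law[OF h r]) (use i x in auto)
    finally show "expectation (\<lambda>\<omega>. of_bool (A i \<omega> \<le> x) * (of_bool (K \<omega> \<le> r) * h (M \<omega>))) =
        expectation (\<lambda>\<omega>. h (M \<omega>) * ((real r - 1 + x) / k) ^ M \<omega>)"
      by (simp add: algebra_simps)
  qed simp
  finally show ?thesis .
qed

lemma integrable_times_farthest:
  assumes Z: "integrable \<Omega> Z"
  shows "integrable \<Omega> (\<lambda>\<omega>. Z \<omega> * A i \<omega>)"
proof (rule Bochner_Integration.integrable_bound[OF Z])
  have [measurable]: "Z \<in> borel_measurable \<Omega>" using Z by (rule borel_measurable_integrable)
  show "(\<lambda>\<omega>. Z \<omega> * A i \<omega>) \<in> borel_measurable \<Omega>" by measurable
  show "AE \<omega> in \<Omega>. norm (Z \<omega> * A i \<omega>) \<le> norm (Z \<omega>)"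
    using AE_farthest[of i] by eventually_elim (auto simp: abs_mult mult_left_le)
qed

lemma integrable_A: "integrable \<Omega> (A i)"
  using integrable_times_farthest[of "\<lambda>_. 1"] by simp

lemma expectation_farthest_last_aisle_le:
  assumes i: "i \<in> {1..r}" and r: "r \<le> k"
  shows "expectation (\<lambda>\<omega>. of_bool (K \<omega> \<le> r) * A i \<omega>) =
    G (real r / k) - (LBINT x:{0..1}. G ((real r - 1 + x) / k))"
proof -
  have Z: "integrable \<Omega> (\<lambda>\<omega>. of_bool (K \<omega> \<le> r) * (1::real))"
    by (rule integrable_of_bool_times) auto
  have ZA: "integrable \<Omega> (\<lambda>\<omega>. of_bool (K \<omega> \<le> r) * A i \<omega>)"
    by (rule integrable_of_bool_times[OF integrable_A]) measurable
  have "(LBINT x:{0..1}. G ((real r - 1 + x) / k)) =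
      expectation (\<lambda>\<omega>. of_bool (K \<omega> \<le> r) * 1 * (1 - A i \<omega>))"
    using expectation_farthest[of "\<lambda>_. 1" r i "\<lambda>x. x" "\<lambda>_. 1"] assms by (simp add: pgf_def)
  also have "\<dots> = expectation (\<lambda>\<omega>. of_bool (K \<omega> \<le> r) * 1) - expectation (\<lambda>\<omega>. of_bool (K \<omega> \<le> r) * A i \<omega>)"
    using Z ZA by (simp add: right_diff_distrib)
  also have "expectation (\<lambda>\<omega>. of_bool (K \<omega> \<le> r) * 1) = G (real r / k)"
    using joint_law[of "\<lambda>_. 1" r "{}"] r by (simp add: pgf_def)
  finally show ?thesis by simp
qed

text \<open>
  The terms with \<open>r < i\<close> drop out: an aisle beyond the last visited one contains no item, and so its
  farthest location is \<open>0\<close>.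
\<close>

lemma expectation_farthest_times_last_aisle:
  assumes i: "i \<in> {1..k}"
  shows "expectation (\<lambda>\<omega>. A i \<omega> * real (K \<omega>)) = k * expectation (A i) -
      (\<Sum>r=i..<k. G (r / k) - (LBINT x:{0..1}. G ((real r - 1 + x) / k)))"
proof -
  have eq: "A i \<omega> * real (K \<omega>) = k * A i \<omega> - (\<Sum>r=0..<k. of_bool (K \<omega> \<le> r) * A i \<omega>)" for \<omega>
    by (subst summation_by_parts_of_bool[OF last_aisle_le_number, of real])
      (simp add: algebra_simps flip: sum_distrib_left)
  have int: "integrable \<Omega> (\<lambda>\<omega>. of_bool (K \<omega> \<le> r) * A i \<omega>)" for r
    by (rule integrable_of_bool_times[OF integrable_A]) measurable
  have "expectation (\<lambda>\<omega>. A i \<omega> * real (K \<omega>)) = k * expectation (A i) -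
      (\<Sum>r=0..<k. expectation (\<lambda>\<omega>. of_bool (K \<omega> \<le> r) * A i \<omega>))"
    unfolding eq Bochner_Integration.integral_diff[OF integrable_mult_right[OF integrable_A]
        Bochner_Integration.integrable_sum[OF int]]
      Bochner_Integration.integral_sum[OF int] integral_mult_right_zero ..
  also have "(\<Sum>r=0..<k. expectation (\<lambda>\<omega>. of_bool (K \<omega> \<le> r) * A i \<omega>)) =
      (\<Sum>r=i..<k. expectation (\<lambda>\<omega>. of_bool (K \<omega> \<le> r) * A i \<omega>))"
  proof (rule sum.mono_neutral_right)
    show "\<forall>r\<in>{0..<k} - {i..<k}. expectation (\<lambda>\<omega>. of_bool (K \<omega> \<le> r) * A i \<omega>) = 0"
    proof
      fix r assume r: "r \<in> {0..<k} - {i..<k}"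
      have "of_bool (K \<omega> \<le> r) * A i \<omega> = 0" for \<omega>
        using farthest_last_aisle_eq_0[OF _ i, of M X \<omega>] r by (cases "K \<omega> \<le> r") auto
      then show "expectation (\<lambda>\<omega>. of_bool (K \<omega> \<le> r) * A i \<omega>) = 0"
        by (simp only: Bochner_Integration.integral_zero)
    qed
  qed auto
  also have "\<dots> = (\<Sum>r=i..<k. G (r / k) - (LBINT x:{0..1}. G ((real r - 1 + x) / k)))"
    using i by (intro sum.cong refl expectation_farthest_last_aisle_le) auto
  finally show "expectation (\<lambda>\<omega>. A i \<omega> * real (K \<omega>)) = k * expectation (A i) -
      (\<Sum>r=i..<k. G (r / k) - (LBINT x:{0..1}. G ((real r - 1 + x) / k)))" .
qed

lemma aisle_fraction: "(real k - 1 + x) / k = 1 - 1 / k + x / k"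
  using aisles by (simp add: field_simps)

lemma expectation_A:
  assumes i: "i \<in> {1..k}"
  shows "expectation (A i) = 1 - (LBINT x:{0..1}. G (1 - 1 / k + x / k))"
  using expectation_farthest[of "\<lambda>_. 1" k i "\<lambda>x. x" "\<lambda>_. 1"] i
  by (simp add: last_aisle_le_number integrable_A prob_space aisle_fraction pgf_def)

lemma integrable_A_square: "integrable \<Omega> (\<lambda>\<omega>. (A i \<omega>)\<^sup>2)"
  using integrable_times_farthest[OF integrable_A, of i i] by (simp add: power2_eq_square)

lemma expectation_A_square:
  assumes i: "i \<in> {1..k}"
  shows "expectation (\<lambda>\<omega>. (A i \<omega>)\<^sup>2) = 1 - 2 * (LBINT x:{0..1}. x * G (1 - 1 / k + x / k))"
proof -
  have "expectation (\<lambda>\<omega>. of_bool (K \<omega> \<le> k) * 1 * (1\<^sup>2 - (A i \<omega>)\<^sup>2)) =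
      (LBINT x:{0..1}. 2 * x * expectation (\<lambda>\<omega>. 1 * ((real k - 1 + x) / k) ^ M \<omega>))"
    by (rule expectation_farthest)
      (use i in \<open>auto intro!: derivative_eq_intros continuous_intros\<close>)
  then have "1 - expectation (\<lambda>\<omega>. (A i \<omega>)\<^sup>2) = (LBINT x:{0..1}. 2 * (x * G (1 - 1 / k + x / k)))"
    by (simp add: last_aisle_le_number integrable_A_square prob_space aisle_fraction pgf_def mult.assoc)
  then show ?thesis by simp
qed

text \<open>
  The product \<open>(1 - A i) (1 - A j)\<close> is easier than \<open>A i * A j\<close>: it is a double tail integral, obtained
  by integrating out one aisle after the other, first with \<open>1 - A j\<close> as the weight and then with
  the event \<open>A i \<le> x\<close>.
\<close>

lemma expectation_A_A:
  assumes i: "i \<in> {1..k}" and j: "j \<in> {1..k}" and ij: "i \<noteq> j"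
  shows "expectation (\<lambda>\<omega>. A i \<omega> * A j \<omega>) = 1 - 2 * (LBINT x:{0..1}. G (1 - 1 / k + x / k))
    + (LBINT x:{0..1}. (LBINT y:{0..1}. G (1 - 2 / k + (x + y) / k)))"
proof -
  have Aj: "integrable \<Omega> (\<lambda>\<omega>. 1 - A j \<omega>)" using integrable_A by simp
  have "expectation (\<lambda>\<omega>. (1 - A j \<omega>) * (1 - A i \<omega>)) =
      (LBINT x:{0..1}. 1 * expectation (\<lambda>\<omega>. of_bool (A i \<omega> \<le> x) * (1 - A j \<omega>)))"
    by (rule layer_cake[OF Aj measurable_A AE_farthest]) auto
  also have "\<dots> = (LBINT x:{0..1}. (LBINT y:{0..1}. G (1 - 2 / k + (x + y) / k)))"
  proof (intro set_lebesgue_integral_cong allI impI)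
    fix x :: real assume x: "x \<in> {0..1}"
    have Z: "integrable \<Omega> (\<lambda>\<omega>. of_bool (A i \<omega> \<le> x) * (1::real))"
      by (rule integrable_of_bool_times) auto
    have "expectation (\<lambda>\<omega>. of_bool (A i \<omega> \<le> x) * 1 * (1 - A j \<omega>)) =
        (LBINT y:{0..1}. 1 * expectation (\<lambda>\<omega>. of_bool (A j \<omega> \<le> y) * (of_bool (A i \<omega> \<le> x) * (1::real))))"
      by (rule layer_cake[OF Z measurable_A AE_farthest]) auto
    also have "\<dots> = (LBINT y:{0..1}. G (1 - 2 / k + (x + y) / k))"
    proof (intro set_lebesgue_integral_cong allI impI)
      fix y :: real assume y: "y \<in> {0..1}"
      let ?t = "\<lambda>a. if a = i then x else y"
      have "expectation (\<lambda>\<omega>. of_bool (A j \<omega> \<le> y) * (of_bool (A i \<omega> \<le> x) * (1::real))) =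
          expectation (\<lambda>\<omega>. of_bool (K \<omega> \<le> k \<and> (\<forall>a\<in>{i, j}. A a \<omega> \<le> ?t a)) * (1::real))"
        by (rule Bochner_Integration.integral_cong) (use ij in \<open>auto simp: last_aisle_le_number\<close>)
      also have "\<dots> = expectation (\<lambda>\<omega>. 1 * ((real k - (\<Sum>a\<in>{i, j}. 1 - ?t a)) / k) ^ M \<omega>)"
        by (rule joint_law) (use i j x y in auto)
      also have "(real k - (\<Sum>a\<in>{i, j}. 1 - ?t a)) / k = 1 - 2 / k + (x + y) / k"
        using ij aisles by (simp add: field_simps)
      finally show "1 * expectation (\<lambda>\<omega>. of_bool (A j \<omega> \<le> y) * (of_bool (A i \<omega> \<le> x) * (1::real))) =
          G (1 - 2 / k + (x + y) / k)" by (simp add: pgf_def)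
    qed simp
    finally show "1 * expectation (\<lambda>\<omega>. of_bool (A i \<omega> \<le> x) * (1 - A j \<omega>)) =
        (LBINT y:{0..1}. G (1 - 2 / k + (x + y) / k))" by simp
  qed simp
  finally have *: "expectation (\<lambda>\<omega>. (1 - A j \<omega>) * (1 - A i \<omega>)) =
      (LBINT x:{0..1}. (LBINT y:{0..1}. G (1 - 2 / k + (x + y) / k)))" .
  have "expectation (\<lambda>\<omega>. (1 - A j \<omega>) * (1 - A i \<omega>)) =
      expectation (\<lambda>\<omega>. 1 - A i \<omega> - A j \<omega> + A i \<omega> * A j \<omega>)"
    by (simp add: algebra_simps)
  also have "\<dots> = 1 - expectation (A i) - expectation (A j) + expectation (\<lambda>\<omega>. A i \<omega> * A j \<omega>)"
    using integrable_A integrable_times_farthest[OF integrable_A] by (simp add: prob_space)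
  finally show ?thesis using * expectation_A[OF i] expectation_A[OF j] by simp
qed

text \<open>
  The weight \<open>M + 1\<close> in place of \<open>M\<close> makes the integral over the threshold elementary:
  \<open>(m + 1) q ^ m\<close> is, up to the factor \<open>k\<close>, the derivative of \<open>q ^ (m + 1)\<close> along
  \<open>q = (k - 1 + x) / k\<close>. Subtracting the case of weight \<open>1\<close> gives the claim.
\<close>

lemma expectation_M_A:
  assumes i: "i \<in> {1..k}"
  shows "expectation (\<lambda>\<omega>. M \<omega> * A i \<omega>) = expectation (\<lambda>\<omega>. M \<omega>) - real k + (real k - 1) * G (1 - 1 / k)
    + (LBINT x:{0..1}. G (1 - 1 / k + x / k))"
proof -
  let ?q = "\<lambda>x. (real k - 1 + x) / k"
  have q: "\<bar>?q x\<bar> \<le> 1" if "x \<in> {0..1}" for x using that aisles by (auto simp: field_simps)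
  \<comment> \<open>A version of \<open>?q\<close> bounded on the whole line, which changes nothing on the unit interval.\<close>
  have clamp: "max (-1) (min 1 (?q x)) = ?q x" if "x \<in> {0..1}" for x
    using q[OF that] unfolding abs_le_iff by linarith
  have int: "integrable \<Omega> (\<lambda>\<omega>. real (M \<omega>) + 1)" using integrable_M by simp
  have power: "integrable \<Omega> (\<lambda>\<omega>. real (M \<omega>) * ?q x ^ M \<omega>)" "integrable \<Omega> (\<lambda>\<omega>. ?q x ^ M \<omega>)"
    if "x \<in> {0..1}" for x
    using integrable_order_size_power[OF integrable_M q[OF that]]
      integrable_order_size_power[of "\<lambda>_. 1", OF _ q[OF that]] by auto
  have "expectation (\<lambda>\<omega>. of_bool (K \<omega> \<le> k) * (real (M \<omega>) + 1) * (1 - A i \<omega>)) =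
      (LBINT x:{0..1}. 1 * expectation (\<lambda>\<omega>. (real (M \<omega>) + 1) * ?q x ^ M \<omega>))"
    by (rule expectation_farthest[where h="\<lambda>m. real m + 1"]) (use i int in auto)
  also have "\<dots> = (LBINT x:{0..1}. 1 * expectation (\<lambda>\<omega>. max (-1) (min 1 (?q x)) ^ M \<omega> * (real (M \<omega>) + 1)))"
    by (intro set_lebesgue_integral_cong allI impI) (simp_all only: clamp mult.commute, simp)
  also have "\<dots> = expectation (\<lambda>\<omega>. (real (M \<omega>) + 1) * (LBINT x:{0..1}. 1 * max (-1) (min 1 (?q x)) ^ M \<omega>))"
  proof (rule expectation_swap_LBINT[symmetric, OF int])
    show "set_integrable lborel {0..1::real} (\<lambda>_. 1 :: real)" unfolding set_integrable_def by simp
    show "(\<lambda>(\<omega>, x). max (-1) (min 1 (?q x)) ^ M \<omega>) \<in> borel_measurable (\<Omega> \<Otimes>\<^sub>M lborel)" by measurable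
    show "\<bar>max (-1) (min 1 (?q x)) ^ M \<omega>\<bar> \<le> 1" for \<omega> x
      unfolding power_abs by (intro power_le_one) auto
  qed
  also have "\<dots> = expectation (\<lambda>\<omega>. k - (real k - 1) * (1 - 1 / k) ^ M \<omega>)"
  proof (intro Bochner_Integration.integral_cong refl)
    fix \<omega>
    let ?F = "\<lambda>x. k * ?q x ^ Suc (M \<omega>)"
    have deriv: "(?F has_real_derivative (real (M \<omega>) + 1) * ?q x ^ M \<omega>) (at x within {0..1})" for x
    proof -
      have "(?q has_real_derivative 1 / k) (at x within {0..1})"
        using aisles by (auto intro!: derivative_eq_intros)
      from DERIV_cmult[OF DERIV_power_Suc[OF this], of k "M \<omega>"] show ?thesis
        by (rule DERIV_cong) (use aisles in \<open>auto simp: add.commute\<close>)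
    qed
    have "(real (M \<omega>) + 1) * (LBINT x:{0..1}. 1 * max (-1) (min 1 (?q x)) ^ M \<omega>) =
        (LBINT x:{0..1}. (real (M \<omega>) + 1) * ?q x ^ M \<omega>)"
      unfolding set_integral_mult_right[symmetric]
      by (intro set_lebesgue_integral_cong allI impI) (simp_all only: clamp, simp_all)
    also have "\<dots> = ?F 1 - ?F 0"
      unfolding set_lebesgue_integral_def
      by (intro integral_FTC_atLeastAtMost)
        (use deriv aisles in \<open>auto intro!: continuous_intros
          simp: has_real_derivative_iff_has_vector_derivative[symmetric] simp del: power_Suc\<close>)
    also have "\<dots> = k - (real k - 1) * (1 - 1 / k) ^ M \<omega>"
      using aisles by (simp add: field_simps)
    finally show "(real (M \<omega>) + 1) * (LBINT x:{0..1}. 1 * max (-1) (min 1 (?q x)) ^ M \<omega>) =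
        k - (real k - 1) * (1 - 1 / k) ^ M \<omega>" .
  qed
  also have "\<dots> = k - (real k - 1) * G (1 - 1 / k)"
    using power(2)[of 0] aisles by (simp add: pgf_def prob_space diff_divide_distrib)
  finally have "expectation (\<lambda>\<omega>. (real (M \<omega>) + 1) * (1 - A i \<omega>)) = k - (real k - 1) * G (1 - 1 / k)"
    by (simp add: last_aisle_le_number)
  moreover have "expectation (\<lambda>\<omega>. (real (M \<omega>) + 1) * (1 - A i \<omega>)) =
      expectation (\<lambda>\<omega>. M \<omega> + 1 - M \<omega> * A i \<omega> - A i \<omega>)"
    by (simp add: algebra_simps)
  moreover have "\<dots> = expectation (\<lambda>\<omega>. M \<omega>) + 1 - expectation (\<lambda>\<omega>. M \<omega> * A i \<omega>) - expectation (A i)"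
    using integrable_M integrable_A integrable_times_farthest[OF integrable_M] by (simp add: prob_space)
  ultimately show ?thesis using expectation_A[OF i] by simp
qed

section \<open>Wald identities for the picking times\<close>

text \<open>
  The two sigma-algebras whose independence is assumed: the one generated by all picking times, and
  the one generated by the order size, the aisles and the locations.
\<close>

definition "times_algebra =
  vimage_algebra (space \<Omega>) (\<lambda>\<omega>. \<lambda>n\<in>{1..}. P n \<omega>) (PiM {1..} (\<lambda>_. borel))"

definition "order_algebra =
  vimage_algebra (space \<Omega>) (\<lambda>\<omega>. (M \<omega>, \<lambda>n\<in>{1..}. (X n \<omega>, U n \<omega>)))
    (count_space UNIV \<Otimes>\<^sub>M PiM {1..} (\<lambda>_. count_space UNIV \<Otimes>\<^sub>M borel))"

lemma measurable_times_algebra: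
  assumes n: "n \<ge> 1"
  shows "P n \<in> borel_measurable times_algebra"
proof -
  have 1: "(\<lambda>\<omega>. \<lambda>n\<in>{1..}. P n \<omega>) \<in> measurable times_algebra (PiM {1..} (\<lambda>_. borel))"
    unfolding times_algebra_def by (rule measurable_vimage_algebra1) (auto simp: space_PiM)
  have 2: "(\<lambda>p. p n) \<in> measurable (PiM {1..} (\<lambda>_. borel)) borel"
    by (rule measurable_component_singleton) (use n in simp)
  show ?thesis using measurable_compose[OF 1 2] n by simp
qed

lemma measurable_order_algebra:
  shows "M \<in> measurable order_algebra (count_space UNIV)"
    and "n \<ge> 1 \<Longrightarrow> X n \<in> measurable order_algebra (count_space UNIV)"
    and "n \<ge> 1 \<Longrightarrow> U n \<in> borel_measurable order_algebra"
proof -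
  have 1: "(\<lambda>\<omega>. (M \<omega>, \<lambda>n\<in>{1..}. (X n \<omega>, U n \<omega>))) \<in> measurable order_algebra
      (count_space UNIV \<Otimes>\<^sub>M PiM {1..} (\<lambda>_. count_space UNIV \<Otimes>\<^sub>M borel))"
    unfolding order_algebra_def
    by (rule measurable_vimage_algebra1) (auto simp: space_PiM space_pair_measure)
  show "M \<in> measurable order_algebra (count_space UNIV)"
    using measurable_compose[OF 1 measurable_fst] by simp
  assume n: "n \<ge> 1"
  have 2: "(\<lambda>p. p n) \<in> measurable (PiM {1..} (\<lambda>_. count_space UNIV \<Otimes>\<^sub>M borel)) (count_space UNIV \<Otimes>\<^sub>M borel)"
    by (rule measurable_component_singleton) (use n in simp)
  have 3: "(\<lambda>\<omega>. (X n \<omega>, U n \<omega>)) \<in> measurable order_algebra (count_space UNIV \<Otimes>\<^sub>M borel)"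
    using measurable_compose[OF measurable_compose[OF 1 measurable_snd] 2] n by simp
  show "X n \<in> measurable order_algebra (count_space UNIV)" "U n \<in> borel_measurable order_algebra"
    using measurable_compose[OF 3 measurable_fst] measurable_compose[OF 3 measurable_snd] by simp_all
qed

lemma indep_var_times_order:
  fixes f g :: "'a \<Rightarrow> real"
  assumes f: "f \<in> borel_measurable \<Omega>" "f \<in> borel_measurable times_algebra"
    and g: "g \<in> borel_measurable \<Omega>" "g \<in> borel_measurable order_algebra"
  shows "indep_var borel f borel g"
proof -
  have "sigma_sets (space \<Omega>) {f -` B \<inter> space \<Omega> |B. B \<in> sets borel} \<subseteq> sets times_algebra"
    using sets.sigma_sets_subset[of "{f -` B \<inter> space \<Omega> |B. B \<in> sets borel}" times_algebra]
      measurable_sets[OF f(2)] by (auto simp: times_algebra_def)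
  moreover have "sigma_sets (space \<Omega>) {g -` B \<inter> space \<Omega> |B. B \<in> sets borel} \<subseteq> sets order_algebra"
    using sets.sigma_sets_subset[of "{g -` B \<inter> space \<Omega> |B. B \<in> sets borel}" order_algebra]
      measurable_sets[OF g(2)] by (auto simp: order_algebra_def)
  moreover have "indep_set (sets times_algebra) (sets order_algebra)"
    using times_indep_order unfolding times_algebra_def order_algebra_def .
  ultimately have "indep_set (sigma_sets (space \<Omega>) {f -` B \<inter> space \<Omega> |B. B \<in> sets borel})
      (sigma_sets (space \<Omega>) {g -` B \<inter> space \<Omega> |B. B \<in> sets borel})"
    unfolding indep_set_def by (elim indep_sets_mono_sets) (auto split: bool.split)
  then show ?thesis unfolding indep_var_eq using f g by blast
qed

lemma expectation_times_order:
  fixes f g :: "'a \<Rightarrow> real"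
  assumes f: "integrable \<Omega> f" "f \<in> borel_measurable times_algebra"
    and g: "integrable \<Omega> g" "g \<in> borel_measurable order_algebra"
  shows "integrable \<Omega> (\<lambda>\<omega>. f \<omega> * g \<omega>)"
    and "expectation (\<lambda>\<omega>. f \<omega> * g \<omega>) = expectation f * expectation g"
proof -
  have "indep_var borel f borel g"
    using f g by (intro indep_var_times_order) auto
  then show "integrable \<Omega> (\<lambda>\<omega>. f \<omega> * g \<omega>)" "expectation (\<lambda>\<omega>. f \<omega> * g \<omega>) = expectation f * expectation g"
    using f(1) g(1) by (auto intro: indep_var_integrable indep_var_lebesgue_integral)
qed

lemma measurable_P [measurable]: "n \<ge> 1 \<Longrightarrow> P n \<in> borel_measurable \<Omega>"
  using times_indep unfolding indep_vars_def by auto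

lemma integrable_P0: "integrable \<Omega> P\<^sub>0"
  by (rule square_integrable_imp_integrable[OF generic_time generic_time_square_integrable])

lemma picking_time_moments:
  fixes f :: "real \<Rightarrow> real"
  assumes n: "n \<ge> 1" and [measurable]: "f \<in> borel_measurable borel"
    and f: "integrable \<Omega> (\<lambda>\<omega>. f (P\<^sub>0 \<omega>))"
  shows "integrable \<Omega> (\<lambda>\<omega>. f (P n \<omega>))" "expectation (\<lambda>\<omega>. f (P n \<omega>)) = expectation (\<lambda>\<omega>. f (P\<^sub>0 \<omega>))"
proof -
  note [measurable] = generic_time measurable_P[OF n]
  have "integrable (distr \<Omega> borel (P n)) f"
    unfolding times_distr[OF n] using f by (subst integrable_distr_eq) auto
  then show "integrable \<Omega> (\<lambda>\<omega>. f (P n \<omega>))" by (subst (asm) integrable_distr_eq) auto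
  have "integral\<^sup>L (distr \<Omega> borel (P n)) f = integral\<^sup>L (distr \<Omega> borel P\<^sub>0) f"
    unfolding times_distr[OF n] ..
  then show "expectation (\<lambda>\<omega>. f (P n \<omega>)) = expectation (\<lambda>\<omega>. f (P\<^sub>0 \<omega>))"
    by (simp add: integral_distr)
qed

lemma expectation_P_P:
  assumes n: "n \<ge> 1" and n': "n' \<ge> 1"
  shows "integrable \<Omega> (\<lambda>\<omega>. P n \<omega> * P n' \<omega>)"
    and "expectation (\<lambda>\<omega>. P n \<omega> * P n' \<omega>) =
      (if n = n' then expectation (\<lambda>\<omega>. (P\<^sub>0 \<omega>)\<^sup>2) else (expectation P\<^sub>0)\<^sup>2)"
proof -
  have P: "integrable \<Omega> (P m)" "expectation (P m) = expectation P\<^sub>0" if "m \<ge> 1" for m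
    using picking_time_moments[OF that, of "\<lambda>x. x"] integrable_P0 by auto
  have "integrable \<Omega> (\<lambda>\<omega>. P n \<omega> * P n' \<omega>) \<and> expectation (\<lambda>\<omega>. P n \<omega> * P n' \<omega>) =
      (if n = n' then expectation (\<lambda>\<omega>. (P\<^sub>0 \<omega>)\<^sup>2) else (expectation P\<^sub>0)\<^sup>2)"
  proof (cases "n = n'")
    case True
    then show ?thesis
      using picking_time_moments[OF n, of "\<lambda>x. x\<^sup>2"] generic_time_square_integrable
      by (simp add: power2_eq_square)
  next
    case False
    have ind: "indep_vars (\<lambda>_. borel) P {n, n'}"
      using n n' by (intro indep_vars_subset[OF times_indep]) auto
    have "integrable \<Omega> (\<lambda>\<omega>. \<Prod>m\<in>{n, n'}. P m \<omega>)"
      by (rule indep_vars_integrable[OF _ ind]) (use P n n' in auto)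
    moreover have "expectation (\<lambda>\<omega>. \<Prod>m\<in>{n, n'}. P m \<omega>) = (\<Prod>m\<in>{n, n'}. expectation (P m))"
      by (rule indep_vars_lebesgue_integral[OF _ ind]) (use P n n' in auto)
    ultimately show ?thesis using False P n n' by (simp add: power2_eq_square)
  qed
  then show "integrable \<Omega> (\<lambda>\<omega>. P n \<omega> * P n' \<omega>)"
    and "expectation (\<lambda>\<omega>. P n \<omega> * P n' \<omega>) =
      (if n = n' then expectation (\<lambda>\<omega>. (P\<^sub>0 \<omega>)\<^sup>2) else (expectation P\<^sub>0)\<^sup>2)" by auto
qed

definition "picking_sum \<omega> = (\<Sum>n=1..M \<omega>. P n \<omega>)"

lemma borel_measurable_picking_sum [measurable]: "picking_sum \<in> borel_measurable \<Omega>"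
proof -
  have 1: "(\<lambda>\<omega>. \<Sum>n=1..m. P n \<omega>) \<in> borel_measurable \<Omega>" for m
    by (intro borel_measurable_sum measurable_P) auto
  have "(\<lambda>\<omega>. \<Sum>n=1..M \<omega>. P n \<omega>) \<in> borel_measurable \<Omega>"
    by (rule measurable_compose_countable[OF 1 measurable_M])
  then show ?thesis unfolding picking_sum_def .
qed

lemma order_size_of_bool:
  fixes Y :: "'a \<Rightarrow> real"
  assumes Y: "integrable \<Omega> Y" "Y \<in> borel_measurable order_algebra"
  shows "integrable \<Omega> (\<lambda>\<omega>. of_bool (M \<omega> = m) * Y \<omega>)"
    and "(\<lambda>\<omega>. of_bool (M \<omega> = m) * Y \<omega>) \<in> borel_measurable order_algebra"
proof -
  note [measurable] = measurable_order_algebra(1) Y(2)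
  show "integrable \<Omega> (\<lambda>\<omega>. of_bool (M \<omega> = m) * Y \<omega>)"
    by (rule integrable_of_bool_times[OF Y(1)]) (use order_size in measurable)
  show "(\<lambda>\<omega>. of_bool (M \<omega> = m) * Y \<omega>) \<in> borel_measurable order_algebra"
    unfolding of_bool_def by measurable
qed

text \<open>
  On \<open>M = m\<close> the square is a sum of \<open>m\<^sup>2\<close> products, each independent of that event; \<open>m\<close> of them are
  squares of a picking time and \<open>m * (m - 1)\<close> are products of two independent ones.
\<close>

lemma wald_square:
  shows "integrable \<Omega> (\<lambda>\<omega>. (picking_sum \<omega>)\<^sup>2)"
    and "expectation (\<lambda>\<omega>. (picking_sum \<omega>)\<^sup>2) =
      expectation (\<lambda>\<omega>. real (M \<omega>) * (real (M \<omega>) - 1)) * (expectation P\<^sub>0)\<^sup>2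
      + expectation (\<lambda>\<omega>. M \<omega>) * expectation (\<lambda>\<omega>. (P\<^sub>0 \<omega>)\<^sup>2)"
proof -
  let ?a = "(expectation P\<^sub>0)\<^sup>2" and ?b = "expectation (\<lambda>\<omega>. (P\<^sub>0 \<omega>)\<^sup>2)"
  let ?g = "\<lambda>\<omega>. (real (M \<omega>) * (real (M \<omega>) - 1)) * ?a + real (M \<omega>) * ?b"
  have MM: "integrable \<Omega> (\<lambda>\<omega>. real (M \<omega>) * (real (M \<omega>) - 1))"
    using order_size_square_integrable integrable_M
    by (simp add: right_diff_distrib power2_eq_square)
  then have g: "integrable \<Omega> ?g" using integrable_M by simp
  have one: "integrable \<Omega> (\<lambda>_. 1::real)" "(\<lambda>_. 1::real) \<in> borel_measurable order_algebra" by auto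
  have PP: "(\<lambda>\<omega>. P n \<omega> * P n' \<omega>) \<in> borel_measurable times_algebra" if "n \<ge> 1" "n' \<ge> 1" for n n'
    using that by (intro borel_measurable_times measurable_times_algebra)
  have eq: "of_bool (M \<omega> = m) * (picking_sum \<omega>)\<^sup>2 =
      (\<Sum>n=1..m. \<Sum>n'=1..m. (P n \<omega> * P n' \<omega>) * (of_bool (M \<omega> = m) * 1))" for m \<omega>
    by (auto simp: picking_sum_def power2_eq_square sum_product)
  have int: "integrable \<Omega> (\<lambda>\<omega>. (P n \<omega> * P n' \<omega>) * (of_bool (M \<omega> = m) * 1))"
    if "n \<in> {1..m}" "n' \<in> {1..m}" for m n n'
    using that by (intro expectation_times_order(1) expectation_P_P(1) PP order_size_of_bool one) auto
  have f: "integrable \<Omega> (\<lambda>\<omega>. of_bool (M \<omega> = m) * (picking_sum \<omega>)\<^sup>2)" for m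
    unfolding eq by (intro Bochner_Integration.integrable_sum int)
  have e: "expectation (\<lambda>\<omega>. of_bool (M \<omega> = m) * (picking_sum \<omega>)\<^sup>2) = expectation (\<lambda>\<omega>. of_bool (M \<omega> = m) * ?g \<omega>)" for m
  proof -
    let ?p = "expectation (\<lambda>\<omega>. of_bool (M \<omega> = m) * 1)"
    have "expectation (\<lambda>\<omega>. of_bool (M \<omega> = m) * (picking_sum \<omega>)\<^sup>2) =
        (\<Sum>n=1..m. \<Sum>n'=1..m. expectation (\<lambda>\<omega>. (P n \<omega> * P n' \<omega>) * (of_bool (M \<omega> = m) * 1)))"
    proof -
      have "expectation (\<lambda>\<omega>. of_bool (M \<omega> = m) * (picking_sum \<omega>)\<^sup>2) =
          (\<Sum>n=1..m. expectation (\<lambda>\<omega>. \<Sum>n'=1..m. (P n \<omega> * P n' \<omega>) * (of_bool (M \<omega> = m) * 1)))"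
        unfolding eq
        by (rule Bochner_Integration.integral_sum) (intro Bochner_Integration.integrable_sum int)
      also have "\<dots> = (\<Sum>n=1..m. \<Sum>n'=1..m. expectation (\<lambda>\<omega>. (P n \<omega> * P n' \<omega>) * (of_bool (M \<omega> = m) * 1)))"
        by (rule sum.cong[OF refl], rule Bochner_Integration.integral_sum) (rule int)
      finally show ?thesis .
    qed
    also have "\<dots> = (\<Sum>n=1..m. \<Sum>n'=1..m. (if n = n' then ?b else ?a) * ?p)"
    proof (intro sum.cong refl)
      fix n n' assume "n \<in> {1..m}" "n' \<in> {1..m}"
      then have n: "n \<ge> 1" "n' \<ge> 1" by auto
      show "expectation (\<lambda>\<omega>. (P n \<omega> * P n' \<omega>) * (of_bool (M \<omega> = m) * 1)) = (if n = n' then ?b else ?a) * ?p"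
        using expectation_times_order(2)[OF expectation_P_P(1)[OF n] PP[OF n] order_size_of_bool[OF one, of m]]
        unfolding expectation_P_P(2)[OF n] .
    qed
    also have "\<dots> = (\<Sum>n=1..m. \<Sum>n'=1..m. ?a + (if n = n' then ?b - ?a else 0)) * ?p"
      unfolding sum_distrib_right by (intro sum.cong refl) auto
    also have "(\<Sum>n=1..m. \<Sum>n'=1..m. ?a + (if n = n' then ?b - ?a else 0)) = real m * (real m - 1) * ?a + real m * ?b"
      by (simp add: sum.distrib algebra_simps)
    also have "(real m * (real m - 1) * ?a + real m * ?b) * ?p =
        expectation (\<lambda>\<omega>. (real m * (real m - 1) * ?a + real m * ?b) * (of_bool (M \<omega> = m) * 1))"
      by (rule integral_mult_right_zero[symmetric])
    also have "\<dots> = expectation (\<lambda>\<omega>. of_bool (M \<omega> = m) * ?g \<omega>)"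
      by (rule Bochner_Integration.integral_cong) auto
    finally show ?thesis .
  qed
  show S: "integrable \<Omega> (\<lambda>\<omega>. (picking_sum \<omega>)\<^sup>2)"
    by (rule integrable_order_sizeI[OF f g _ e]) simp
  show "expectation (\<lambda>\<omega>. (picking_sum \<omega>)\<^sup>2) =
      expectation (\<lambda>\<omega>. real (M \<omega>) * (real (M \<omega>) - 1)) * ?a + expectation (\<lambda>\<omega>. M \<omega>) * ?b"
    using expectation_eqI_order_size[OF S g e] MM integrable_M by simp
qed

lemma integrable_picking_sum: "integrable \<Omega> picking_sum"
  by (rule square_integrable_imp_integrable[OF borel_measurable_picking_sum wald_square(1)])

text \<open>
  A factor \<open>Y\<close> determined by the order is independent of every single picking time, also after
  restriction to \<open>M = m\<close>. Thus each of the \<open>m\<close> picking times can be replaced by its mean.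
\<close>

lemma wald_product:
  fixes Y :: "'a \<Rightarrow> real"
  assumes Y: "integrable \<Omega> Y" "Y \<in> borel_measurable order_algebra"
    and MY: "integrable \<Omega> (\<lambda>\<omega>. M \<omega> * Y \<omega>)" and SY: "integrable \<Omega> (\<lambda>\<omega>. picking_sum \<omega> * Y \<omega>)"
  shows "expectation (\<lambda>\<omega>. picking_sum \<omega> * Y \<omega>) = expectation P\<^sub>0 * expectation (\<lambda>\<omega>. M \<omega> * Y \<omega>)"
proof -
  have P: "integrable \<Omega> (P n)" "expectation (P n) = expectation P\<^sub>0" if "n \<ge> 1" for n
    using picking_time_moments[OF that, of "\<lambda>x. x"] integrable_P0 by auto
  have "expectation (\<lambda>\<omega>. picking_sum \<omega> * Y \<omega>) = expectation (\<lambda>\<omega>. expectation P\<^sub>0 * (M \<omega> * Y \<omega>))"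
  proof (rule expectation_eqI_order_size[OF SY])
    show "integrable \<Omega> (\<lambda>\<omega>. expectation P\<^sub>0 * (M \<omega> * Y \<omega>))" using MY by simp
    fix m
    let ?Y = "\<lambda>\<omega>. of_bool (M \<omega> = m) * Y \<omega>"
    note t = expectation_times_order[OF P(1) measurable_times_algebra order_size_of_bool[OF Y, of m]]
    have "expectation (\<lambda>\<omega>. of_bool (M \<omega> = m) * (picking_sum \<omega> * Y \<omega>)) = expectation (\<lambda>\<omega>. \<Sum>n=1..m. P n \<omega> * ?Y \<omega>)"
      by (rule Bochner_Integration.integral_cong) (auto simp: picking_sum_def sum_distrib_right)
    also have "\<dots> = (\<Sum>n=1..m. expectation (\<lambda>\<omega>. P n \<omega> * ?Y \<omega>))"
      by (rule Bochner_Integration.integral_sum) (auto intro: t(1))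
    also have "\<dots> = (\<Sum>n=1..m. expectation P\<^sub>0 * expectation ?Y)"
      by (intro sum.cong refl) (simp add: t(2) P(2))
    also have "\<dots> = expectation (\<lambda>\<omega>. (real m * expectation P\<^sub>0) * ?Y \<omega>)"
      by simp
    also have "\<dots> = expectation (\<lambda>\<omega>. of_bool (M \<omega> = m) * (expectation P\<^sub>0 * (M \<omega> * Y \<omega>)))"
      by (rule Bochner_Integration.integral_cong) auto
    finally show "expectation (\<lambda>\<omega>. of_bool (M \<omega> = m) * (picking_sum \<omega> * Y \<omega>)) =
        expectation (\<lambda>\<omega>. of_bool (M \<omega> = m) * (expectation P\<^sub>0 * (M \<omega> * Y \<omega>)))" .
  qed
  then show ?thesis by simp
qed

section \<open>The total picking time\<close>

lemma integrable_times_last_aisle: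
  assumes Z: "integrable \<Omega> Z"
  shows "integrable \<Omega> (\<lambda>\<omega>. Z \<omega> * real (K \<omega>))"
proof (rule Bochner_Integration.integrable_bound)
  have [measurable]: "Z \<in> borel_measurable \<Omega>" using Z by (rule borel_measurable_integrable)
  show "integrable \<Omega> (\<lambda>\<omega>. Z \<omega> * k)" using Z by simp
  show "(\<lambda>\<omega>. Z \<omega> * real (K \<omega>)) \<in> borel_measurable \<Omega>" by measurable
  show "AE \<omega> in \<Omega>. norm (Z \<omega> * real (K \<omega>)) \<le> norm (Z \<omega> * k)"
    by (intro AE_I2) (auto simp: abs_mult last_aisle_le_number intro!: mult_left_mono)
qed

lemma measurable_order_algebra_A: "A i \<in> borel_measurable order_algebra"
  by (rule borel_measurable_farthest[OF measurable_order_algebra])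

lemma measurable_order_algebra_K: "(\<lambda>\<omega>. real (K \<omega>)) \<in> borel_measurable order_algebra"
  by (rule borel_measurable_last_aisle[OF measurable_order_algebra(1,2)])

lemma integrable_K: "integrable \<Omega> (\<lambda>\<omega>. real (K \<omega>))"
  using integrable_times_last_aisle[of "\<lambda>_. 1"] by simp

lemma expectation_picking_sum: "expectation picking_sum = expectation P\<^sub>0 * expectation (\<lambda>\<omega>. M \<omega>)"
  using wald_product[of "\<lambda>_. 1"] integrable_M integrable_picking_sum by simp

lemma expectation_picking_sum_A: "expectation (\<lambda>\<omega>. picking_sum \<omega> * A i \<omega>) = expectation P\<^sub>0 * expectation (\<lambda>\<omega>. M \<omega> * A i \<omega>)"
  by (intro wald_product integrable_A measurable_order_algebra_A
    integrable_times_farthest integrable_M integrable_picking_sum)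

lemma expectation_picking_sum_K:
  "expectation (\<lambda>\<omega>. picking_sum \<omega> * real (K \<omega>)) = expectation P\<^sub>0 * expectation (\<lambda>\<omega>. M \<omega> * real (K \<omega>))"
  by (intro wald_product integrable_K measurable_order_algebra_K
    integrable_times_last_aisle integrable_M integrable_picking_sum)

lemma return_time_eq:
  "return_time k l w\<^sub>a v M X U P \<omega> =
    picking_sum \<omega> + 2 * l / v * (\<Sum>i=1..k. A i \<omega>) + 2 * w\<^sub>a / v * (real (K \<omega>) - 1)"
  by (simp add: return_time_def picking_sum_def)

lemma expectation_return_time:
  fixes l w\<^sub>a v :: real
  assumes i: "i \<in> {1..k}"
  shows "integrable \<Omega> (return_time k l w\<^sub>a v M X U P)"
    and "expectation (return_time k l w\<^sub>a v M X U P) =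
      expectation (\<lambda>\<omega>. M \<omega>) * expectation P\<^sub>0 + 2 * l * k / v * expectation (A i)
        + 2 * w\<^sub>a / v * (expectation (\<lambda>\<omega>. K \<omega>) - 1)"
proof -
  have D: "integrable \<Omega> (\<lambda>\<omega>. \<Sum>i=1..k. A i \<omega>)"
    by (intro Bochner_Integration.integrable_sum integrable_A)
  have eq: "return_time k l w\<^sub>a v M X U P =
      (\<lambda>\<omega>. picking_sum \<omega> + 2 * l / v * (\<Sum>i=1..k. A i \<omega>) + 2 * w\<^sub>a / v * (real (K \<omega>) - 1))"
    by (rule ext) (rule return_time_eq)
  show "integrable \<Omega> (return_time k l w\<^sub>a v M X U P)"
    unfolding eq using D integrable_picking_sum integrable_K by simp
  have "expectation (\<lambda>\<omega>. \<Sum>i=1..k. A i \<omega>) = (\<Sum>i'=1..k. expectation (A i))"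
    unfolding Bochner_Integration.integral_sum[OF integrable_A]
    by (intro sum.cong refl) (simp add: expectation_A expectation_A[OF i])
  then have D': "expectation (\<lambda>\<omega>. \<Sum>i=1..k. A i \<omega>) = k * expectation (A i)" by simp
  have "expectation (return_time k l w\<^sub>a v M X U P) =
      expectation picking_sum + 2 * l / v * expectation (\<lambda>\<omega>. \<Sum>i=1..k. A i \<omega>)
        + 2 * w\<^sub>a / v * (expectation (\<lambda>\<omega>. K \<omega>) - 1)"
    unfolding eq using D integrable_picking_sum integrable_K by (simp add: prob_space)
  then show "expectation (return_time k l w\<^sub>a v M X U P) =
      expectation (\<lambda>\<omega>. M \<omega>) * expectation P\<^sub>0 + 2 * l * k / v * expectation (A i)
        + 2 * w\<^sub>a / v * (expectation (\<lambda>\<omega>. K \<omega>) - 1)"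
    unfolding D' expectation_picking_sum by simp
qed

text \<open>
  Write \<open>D\<close> for the sum of the farthest locations and \<open>R\<close> for \<open>K - 1\<close>. The six products among the sum
  of picking times, \<open>D\<close> and \<open>R\<close> are evaluated one by one; since the moments of the \<open>A i\<close> are the same
  for all aisles and all pairs of distinct aisles, sums over aisles become multiples of one term.
\<close>

lemma expectation_return_time_square:
  fixes l w\<^sub>a v :: real
  assumes i: "i \<in> {1..k}" and j: "j \<in> {1..k}" and ij: "i \<noteq> j \<or> k = 1"
  shows "integrable \<Omega> (\<lambda>\<omega>. (return_time k l w\<^sub>a v M X U P \<omega>)\<^sup>2)"
    and "expectation (\<lambda>\<omega>. (return_time k l w\<^sub>a v M X U P \<omega>)\<^sup>2) =
      expectation (\<lambda>\<omega>. real (M \<omega>) * (real (M \<omega>) - 1)) * (expectation P\<^sub>0)\<^sup>2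
      + expectation (\<lambda>\<omega>. M \<omega>) * expectation (\<lambda>\<omega>. (P\<^sub>0 \<omega>)\<^sup>2)
      + 4 * l\<^sup>2 / v\<^sup>2 * (real k * expectation (\<lambda>\<omega>. (A i \<omega>)\<^sup>2)
          + real k * (real k - 1) * expectation (\<lambda>\<omega>. A i \<omega> * A j \<omega>))
      + 4 * w\<^sub>a\<^sup>2 / v\<^sup>2 * (expectation (\<lambda>\<omega>. (real (K \<omega>))\<^sup>2) - 2 * expectation (\<lambda>\<omega>. K \<omega>) + 1)
      + 4 * l * k / v * expectation P\<^sub>0 * expectation (\<lambda>\<omega>. M \<omega> * A i \<omega>)
      + 4 * w\<^sub>a / v * expectation P\<^sub>0 * (expectation (\<lambda>\<omega>. M \<omega> * real (K \<omega>)) - expectation (\<lambda>\<omega>. M \<omega>))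
      + 8 * w\<^sub>a * l / v\<^sup>2 *
          ((\<Sum>i'=1..k. expectation (\<lambda>\<omega>. A i' \<omega> * real (K \<omega>))) - real k * expectation (A i))"
proof -
  let ?D = "\<lambda>\<omega>. \<Sum>i=1..k. A i \<omega>"
  let ?R = "\<lambda>\<omega>. real (K \<omega>) - 1"
  let ?\<alpha> = "2 * l / v" and ?\<beta> = "2 * w\<^sub>a / v"
  have AA: "integrable \<Omega> (\<lambda>\<omega>. A a \<omega> * A b \<omega>)" for a b
    by (intro integrable_times_farthest integrable_A)
  have AK: "integrable \<Omega> (\<lambda>\<omega>. A a \<omega> * real (K \<omega>))" for a
    by (intro integrable_times_last_aisle integrable_A)
  have SA: "integrable \<Omega> (\<lambda>\<omega>. picking_sum \<omega> * A a \<omega>)" for a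
    by (intro integrable_times_farthest integrable_picking_sum)
  have SK: "integrable \<Omega> (\<lambda>\<omega>. picking_sum \<omega> * real (K \<omega>))"
    by (intro integrable_times_last_aisle integrable_picking_sum)
  have KK: "integrable \<Omega> (\<lambda>\<omega>. (real (K \<omega>))\<^sup>2)"
    unfolding power2_eq_square by (intro integrable_times_last_aisle integrable_K)

  have DD_eq: "(?D \<omega>)\<^sup>2 = (\<Sum>a=1..k. \<Sum>b=1..k. A a \<omega> * A b \<omega>)" for \<omega>
    by (simp add: power2_eq_square sum_product)
  have DD: "integrable \<Omega> (\<lambda>\<omega>. (?D \<omega>)\<^sup>2)"
    unfolding DD_eq by (intro Bochner_Integration.integrable_sum AA)
  have "expectation (\<lambda>\<omega>. (?D \<omega>)\<^sup>2) = (\<Sum>a=1..k. \<Sum>b=1..k. expectation (\<lambda>\<omega>. A a \<omega> * A b \<omega>))"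
    unfolding DD_eq Bochner_Integration.integral_sum[OF Bochner_Integration.integrable_sum[OF AA]]
      Bochner_Integration.integral_sum[OF AA] ..
  also have "\<dots> = (\<Sum>a=1..k. \<Sum>b=1..k. expectation (\<lambda>\<omega>. A i \<omega> * A j \<omega>) +
      (if a = b then expectation (\<lambda>\<omega>. (A i \<omega>)\<^sup>2) - expectation (\<lambda>\<omega>. A i \<omega> * A j \<omega>) else 0))"
  proof (intro sum.cong refl)
    fix a b assume ab: "a \<in> {1..k}" "b \<in> {1..k}"
    show "expectation (\<lambda>\<omega>. A a \<omega> * A b \<omega>) = expectation (\<lambda>\<omega>. A i \<omega> * A j \<omega>) +
      (if a = b then expectation (\<lambda>\<omega>. (A i \<omega>)\<^sup>2) - expectation (\<lambda>\<omega>. A i \<omega> * A j \<omega>) else 0)"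
    proof (cases "a = b")
      case True
      then show ?thesis
        using expectation_A_square[OF ab(1)] expectation_A_square[OF i] by (simp add: power2_eq_square)
    next
      case False
      \<comment> \<open>Two distinct aisles exist, so \<open>k\<close> is not \<open>1\<close>.\<close>
      then have "i \<noteq> j" using ij ab by auto
      then show ?thesis using False expectation_A_A[OF ab] expectation_A_A[OF i j] by simp
    qed
  qed
  also have "\<dots> = real k * expectation (\<lambda>\<omega>. (A i \<omega>)\<^sup>2) + real k * (real k - 1) * expectation (\<lambda>\<omega>. A i \<omega> * A j \<omega>)"
    by (simp add: sum.distrib algebra_simps)
  finally have DD': "expectation (\<lambda>\<omega>. (?D \<omega>)\<^sup>2) = \<dots>" .

  have DR_eq: "?D \<omega> * ?R \<omega> = (\<Sum>a=1..k. A a \<omega> * real (K \<omega>) - A a \<omega>)" for \<omega>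
    by (simp add: sum_distrib_right right_diff_distrib sum_subtractf)
  have DR: "integrable \<Omega> (\<lambda>\<omega>. ?D \<omega> * ?R \<omega>)"
    unfolding DR_eq by (intro Bochner_Integration.integrable_sum Bochner_Integration.integrable_diff AK integrable_A)
  have "expectation (\<lambda>\<omega>. ?D \<omega> * ?R \<omega>) = (\<Sum>a=1..k. expectation (\<lambda>\<omega>. A a \<omega> * real (K \<omega>)) - expectation (A a))"
    unfolding DR_eq Bochner_Integration.integral_sum[OF Bochner_Integration.integrable_diff[OF AK integrable_A]]
      Bochner_Integration.integral_diff[OF AK integrable_A] ..
  also have "\<dots> = (\<Sum>a=1..k. expectation (\<lambda>\<omega>. A a \<omega> * real (K \<omega>)) - expectation (A i))"
    by (intro sum.cong refl) (simp add: expectation_A expectation_A[OF i])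
  finally have DR': "expectation (\<lambda>\<omega>. ?D \<omega> * ?R \<omega>) =
      (\<Sum>a=1..k. expectation (\<lambda>\<omega>. A a \<omega> * real (K \<omega>))) - real k * expectation (A i)"
    by (simp add: sum_subtractf)

  have SD_eq: "picking_sum \<omega> * ?D \<omega> = (\<Sum>a=1..k. picking_sum \<omega> * A a \<omega>)" for \<omega> by (rule sum_distrib_left)
  have SD: "integrable \<Omega> (\<lambda>\<omega>. picking_sum \<omega> * ?D \<omega>)"
    unfolding SD_eq by (intro Bochner_Integration.integrable_sum SA)
  have "expectation (\<lambda>\<omega>. picking_sum \<omega> * ?D \<omega>) = (\<Sum>a=1..k. expectation P\<^sub>0 * expectation (\<lambda>\<omega>. M \<omega> * A a \<omega>))"
    unfolding SD_eq Bochner_Integration.integral_sum[OF SA] expectation_picking_sum_A ..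
  also have "\<dots> = (\<Sum>a=1..k. expectation P\<^sub>0 * expectation (\<lambda>\<omega>. M \<omega> * A i \<omega>))"
    by (intro sum.cong refl) (simp add: expectation_M_A expectation_M_A[OF i])
  finally have SD': "expectation (\<lambda>\<omega>. picking_sum \<omega> * ?D \<omega>) = k * (expectation P\<^sub>0 * expectation (\<lambda>\<omega>. M \<omega> * A i \<omega>))"
    by simp

  have SR: "integrable \<Omega> (\<lambda>\<omega>. picking_sum \<omega> * ?R \<omega>)"
    using SK integrable_picking_sum by (simp add: right_diff_distrib)
  have SR': "expectation (\<lambda>\<omega>. picking_sum \<omega> * ?R \<omega>) =
      expectation P\<^sub>0 * (expectation (\<lambda>\<omega>. M \<omega> * real (K \<omega>)) - expectation (\<lambda>\<omega>. M \<omega>))"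
    using SK integrable_picking_sum expectation_picking_sum_K expectation_picking_sum by (simp add: right_diff_distrib)

  have RR_eq: "(?R \<omega>)\<^sup>2 = (real (K \<omega>))\<^sup>2 - 2 * real (K \<omega>) + 1" for \<omega>
    by (simp add: power2_eq_square algebra_simps)
  have RR: "integrable \<Omega> (\<lambda>\<omega>. (?R \<omega>)\<^sup>2)"
    unfolding RR_eq using KK integrable_K by simp
  have RR': "expectation (\<lambda>\<omega>. (?R \<omega>)\<^sup>2) =
      expectation (\<lambda>\<omega>. (real (K \<omega>))\<^sup>2) - 2 * expectation (\<lambda>\<omega>. K \<omega>) + 1"
    unfolding RR_eq using KK integrable_K by (simp add: prob_space)

  have eq: "(return_time k l w\<^sub>a v M X U P \<omega>)\<^sup>2 = (picking_sum \<omega>)\<^sup>2 + ?\<alpha>\<^sup>2 * (?D \<omega>)\<^sup>2 + ?\<beta>\<^sup>2 * (?R \<omega>)\<^sup>2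
      + 2 * ?\<alpha> * (picking_sum \<omega> * ?D \<omega>) + 2 * ?\<beta> * (picking_sum \<omega> * ?R \<omega>) + 2 * ?\<alpha> * ?\<beta> * (?D \<omega> * ?R \<omega>)" for \<omega>
  proof -
    have sq: "(s + a * d + b * r)\<^sup>2 = s\<^sup>2 + a\<^sup>2 * d\<^sup>2 + b\<^sup>2 * r\<^sup>2 + 2 * a * (s * d) + 2 * b * (s * r)
        + 2 * a * b * (d * r)" for s a d b r :: real
      by (simp add: power2_eq_square algebra_simps)
    show ?thesis unfolding return_time_eq by (rule sq)
  qed
  show "integrable \<Omega> (\<lambda>\<omega>. (return_time k l w\<^sub>a v M X U P \<omega>)\<^sup>2)"
    unfolding eq
    by (intro Bochner_Integration.integrable_add integrable_mult_right wald_square(1) DD RR SD SR DR)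
  have "expectation (\<lambda>\<omega>. (return_time k l w\<^sub>a v M X U P \<omega>)\<^sup>2) =
      expectation (\<lambda>\<omega>. (picking_sum \<omega>)\<^sup>2) + ?\<alpha>\<^sup>2 * expectation (\<lambda>\<omega>. (?D \<omega>)\<^sup>2) + ?\<beta>\<^sup>2 * expectation (\<lambda>\<omega>. (?R \<omega>)\<^sup>2)
      + 2 * ?\<alpha> * expectation (\<lambda>\<omega>. picking_sum \<omega> * ?D \<omega>) + 2 * ?\<beta> * expectation (\<lambda>\<omega>. picking_sum \<omega> * ?R \<omega>)
      + 2 * ?\<alpha> * ?\<beta> * expectation (\<lambda>\<omega>. ?D \<omega> * ?R \<omega>)"
    unfolding eq
    by (simp only: Bochner_Integration.integral_add integral_mult_right_zero
      Bochner_Integration.integrable_add integrable_mult_right wald_square(1) DD RR SD SR DR)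
  then show "expectation (\<lambda>\<omega>. (return_time k l w\<^sub>a v M X U P \<omega>)\<^sup>2) =
      expectation (\<lambda>\<omega>. real (M \<omega>) * (real (M \<omega>) - 1)) * (expectation P\<^sub>0)\<^sup>2
      + expectation (\<lambda>\<omega>. M \<omega>) * expectation (\<lambda>\<omega>. (P\<^sub>0 \<omega>)\<^sup>2)
      + 4 * l\<^sup>2 / v\<^sup>2 * (real k * expectation (\<lambda>\<omega>. (A i \<omega>)\<^sup>2)
          + real k * (real k - 1) * expectation (\<lambda>\<omega>. A i \<omega> * A j \<omega>))
      + 4 * w\<^sub>a\<^sup>2 / v\<^sup>2 * (expectation (\<lambda>\<omega>. (real (K \<omega>))\<^sup>2) - 2 * expectation (\<lambda>\<omega>. K \<omega>) + 1)
      + 4 * l * k / v * expectation P\<^sub>0 * expectation (\<lambda>\<omega>. M \<omega> * A i \<omega>)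
      + 4 * w\<^sub>a / v * expectation P\<^sub>0 * (expectation (\<lambda>\<omega>. M \<omega> * real (K \<omega>)) - expectation (\<lambda>\<omega>. M \<omega>))
      + 8 * w\<^sub>a * l / v\<^sup>2 *
          ((\<Sum>i'=1..k. expectation (\<lambda>\<omega>. A i' \<omega> * real (K \<omega>))) - real k * expectation (A i))"
    unfolding wald_square(2) DD' RR' SD' SR' DR' by (simp add: power_divide power_mult_distrib power2_eq_square mult_ac)
qed

lemma expectation_K_moments:
  shows "expectation (\<lambda>\<omega>. K \<omega>) = real k - (\<Sum>r=0..<k. G (r / k))"
    and "expectation (\<lambda>\<omega>. (real (K \<omega>))\<^sup>2) = (real k)\<^sup>2 - (\<Sum>r=0..<k. (2 * real r + 1) * G (r / k))"
    and "expectation (\<lambda>\<omega>. M \<omega> * real (K \<omega>)) =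
      k * expectation (\<lambda>\<omega>. M \<omega>) - (\<Sum>r=0..<k. r / k * pgf_deriv \<Omega> M (r / k))"
proof -
  show "expectation (\<lambda>\<omega>. K \<omega>) = real k - (\<Sum>r=0..<k. G (r / k))"
    using expectation_last_aisle[of "\<lambda>_. 1" real] by (simp add: prob_space pgf_def)
  have "(real (Suc r))\<^sup>2 - (real r)\<^sup>2 = 2 * real r + 1" for r
    by (simp add: power2_eq_square algebra_simps)
  then show "expectation (\<lambda>\<omega>. (real (K \<omega>))\<^sup>2) = (real k)\<^sup>2 - (\<Sum>r=0..<k. (2 * real r + 1) * G (r / k))"
    using expectation_last_aisle[of "\<lambda>_. 1" "\<lambda>m. (real m)\<^sup>2"]
    by (simp add: prob_space pgf_def del: of_nat_Suc)
  have "expectation (\<lambda>\<omega>. M \<omega> * real (K \<omega>)) = real k * expectation (\<lambda>\<omega>. M \<omega>) -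
      (\<Sum>r=0..<k. (real (Suc r) - real r) * expectation (\<lambda>\<omega>. real (M \<omega>) * (real r / k) ^ M \<omega>))"
    by (rule expectation_last_aisle[OF integrable_M])
  also have "(\<Sum>r=0..<k. (real (Suc r) - real r) * expectation (\<lambda>\<omega>. real (M \<omega>) * (real r / k) ^ M \<omega>)) =
      (\<Sum>r=0..<k. r / k * pgf_deriv \<Omega> M (r / k))"
    using pgf_deriv_times[of "real r / real k" for r] by (intro sum.cong refl) simp
  finally show "expectation (\<lambda>\<omega>. M \<omega> * real (K \<omega>)) =
      k * expectation (\<lambda>\<omega>. M \<omega>) - (\<Sum>r=0..<k. r / k * pgf_deriv \<Omega> M (r / k))" .
qed

end

theorem theorem5p1:
  fixes \<Omega> :: "'a measure" and k :: nat and l w\<^sub>a v :: real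
    and M :: "'a \<Rightarrow> nat" and X :: "nat \<Rightarrow> 'a \<Rightarrow> nat" and U :: "nat \<Rightarrow> 'a \<Rightarrow> real"
    and P :: "nat \<Rightarrow> 'a \<Rightarrow> real" and P\<^sub>0 :: "'a \<Rightarrow> real"
    and E :: "('a \<Rightarrow> real) \<Rightarrow> real" and A :: "nat \<Rightarrow> 'a \<Rightarrow> real" and K T :: "'a \<Rightarrow> real"
    and G G' :: "real \<Rightarrow> real"
  defines "E \<equiv> integral\<^sup>L \<Omega>"
    and "A \<equiv> farthest M X U"
    and "K \<equiv> (\<lambda>\<omega>. real (last_aisle k M X \<omega>))"
    and "T \<equiv> return_time k l w\<^sub>a v M X U P"
    and "G \<equiv> pgf \<Omega> M"
    and "G' \<equiv> pgf_deriv \<Omega> M"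
  assumes "k \<ge> 1" and "l > 0" and "w\<^sub>a > 0" and "v > 0"
    and "order_picking \<Omega> k M X U P P\<^sub>0"
  shows
    "\<comment> \<open>all expectations below exist\<close>
     integrable \<Omega> T \<and> integrable \<Omega> (\<lambda>\<omega>. (T \<omega>)\<^sup>2) \<and>
     integrable \<Omega> K \<and> integrable \<Omega> (\<lambda>\<omega>. (K \<omega>)\<^sup>2) \<and> integrable \<Omega> (\<lambda>\<omega>. M \<omega> * K \<omega>) \<and>
     (\<forall>i\<in>{1..k}. integrable \<Omega> (A i) \<and> integrable \<Omega> (\<lambda>\<omega>. (A i \<omega>)\<^sup>2) \<and>
        integrable \<Omega> (\<lambda>\<omega>. M \<omega> * A i \<omega>) \<and> integrable \<Omega> (\<lambda>\<omega>. A i \<omega> * K \<omega>)) \<and>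
     (\<forall>i\<in>{1..k}. \<forall>j\<in>{1..k}. i \<noteq> j \<longrightarrow> integrable \<Omega> (\<lambda>\<omega>. A i \<omega> * A j \<omega>)) \<and>
     \<comment> \<open>first moment\<close>
     (\<forall>i\<in>{1..k}.
        E T = E (\<lambda>\<omega>. M \<omega>) * E P\<^sub>0 + 2 * l * k / v * E (A i) + 2 * w\<^sub>a / v * (E K - 1)) \<and>
     \<comment> \<open>second moment; for \<open>k = 1\<close> the product term has coefficient \<open>0\<close>\<close>
     (\<forall>i\<in>{1..k}. \<forall>j\<in>{1..k}. i \<noteq> j \<or> k = 1 \<longrightarrow>
        E (\<lambda>\<omega>. (T \<omega>)\<^sup>2) =
          E (\<lambda>\<omega>. real (M \<omega>) * (real (M \<omega>) - 1)) * (E P\<^sub>0)\<^sup>2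
          + E (\<lambda>\<omega>. M \<omega>) * E (\<lambda>\<omega>. (P\<^sub>0 \<omega>)\<^sup>2)
          + 4 * l\<^sup>2 / v\<^sup>2 *
              (real k * E (\<lambda>\<omega>. (A i \<omega>)\<^sup>2) + real k * (real k - 1) * E (\<lambda>\<omega>. A i \<omega> * A j \<omega>))
          + 4 * w\<^sub>a\<^sup>2 / v\<^sup>2 * (E (\<lambda>\<omega>. (K \<omega>)\<^sup>2) - 2 * E K + 1)
          + 4 * l * k / v * E P\<^sub>0 * E (\<lambda>\<omega>. M \<omega> * A i \<omega>)
          + 4 * w\<^sub>a / v * E P\<^sub>0 * (E (\<lambda>\<omega>. M \<omega> * K \<omega>) - E (\<lambda>\<omega>. M \<omega>))
          + 8 * w\<^sub>a * l / v\<^sup>2 *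
              ((\<Sum>i'=1..k. E (\<lambda>\<omega>. A i' \<omega> * K \<omega>)) - real k * E (A i))) \<and>
     \<comment> \<open>independence of the aisle, and of the pair of aisles\<close>
     (\<forall>i\<in>{1..k}. \<forall>i'\<in>{1..k}.
        E (A i) = E (A i') \<and> E (\<lambda>\<omega>. (A i \<omega>)\<^sup>2) = E (\<lambda>\<omega>. (A i' \<omega>)\<^sup>2) \<and>
        E (\<lambda>\<omega>. M \<omega> * A i \<omega>) = E (\<lambda>\<omega>. M \<omega> * A i' \<omega>)) \<and>
     (\<forall>i\<in>{1..k}. \<forall>j\<in>{1..k}. \<forall>i'\<in>{1..k}. \<forall>j'\<in>{1..k}. i \<noteq> j \<and> i' \<noteq> j' \<longrightarrow>
        E (\<lambda>\<omega>. A i \<omega> * A j \<omega>) = E (\<lambda>\<omega>. A i' \<omega> * A j' \<omega>)) \<and>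
     \<comment> \<open>moments of the last aisle\<close>
     E K = real k - (\<Sum>r=0..<k. G (r / k)) \<and>
     E (\<lambda>\<omega>. (K \<omega>)\<^sup>2) = (real k)\<^sup>2 - (\<Sum>r=0..<k. (2 * real r + 1) * G (r / k)) \<and>
     E (\<lambda>\<omega>. M \<omega> * K \<omega>) = k * E (\<lambda>\<omega>. M \<omega>) - (\<Sum>r=0..<k. r / k * G' (r / k)) \<and>
     \<comment> \<open>moments of the farthest locations\<close>
     (\<forall>i\<in>{1..k}.
        E (A i) = 1 - (LBINT x:{0..1}. G (1 - 1 / k + x / k)) \<and>
        E (\<lambda>\<omega>. (A i \<omega>)\<^sup>2) = 1 - 2 * (LBINT x:{0..1}. x * G (1 - 1 / k + x / k)) \<and>
        E (\<lambda>\<omega>. M \<omega> * A i \<omega>) =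
          E (\<lambda>\<omega>. M \<omega>) - real k + (real k - 1) * G (1 - 1 / k) + (LBINT x:{0..1}. G (1 - 1 / k + x / k)) \<and>
        E (\<lambda>\<omega>. A i \<omega> * K \<omega>) =
          k * E (A i) - (\<Sum>r=i..<k. G (r / k) - (LBINT x:{0..1}. G ((real r - 1 + x) / k)))) \<and>
     (\<forall>i\<in>{1..k}. \<forall>j\<in>{1..k}. i \<noteq> j \<longrightarrow>
        E (\<lambda>\<omega>. A i \<omega> * A j \<omega>) =
          1 - 2 * (LBINT x:{0..1}. G (1 - 1 / k + x / k))
          + (LBINT x:{0..1}. (LBINT y:{0..1}. G (1 - 2 / k + (x + y) / k))))"
proof -
  interpret order_picking_aisles \<Omega> k M X U P P\<^sub>0
    by (intro order_picking_aisles.intro order_picking_aisles_axioms.intro assms)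
  have T: "integrable \<Omega> T" "integrable \<Omega> (\<lambda>\<omega>. (T \<omega>)\<^sup>2)"
    unfolding T_def using aisles
    by (intro expectation_return_time(1)[of 1] expectation_return_time_square(1)[of 1 k]; force)+
  have K: "integrable \<Omega> K" "integrable \<Omega> (\<lambda>\<omega>. (K \<omega>)\<^sup>2)" "integrable \<Omega> (\<lambda>\<omega>. M \<omega> * K \<omega>)"
    unfolding K_def power2_eq_square
    by (intro integrable_times_last_aisle integrable_K integrable_M)+
  have A: "integrable \<Omega> (A i)" "integrable \<Omega> (\<lambda>\<omega>. (A i \<omega>)\<^sup>2)" "integrable \<Omega> (\<lambda>\<omega>. M \<omega> * A i \<omega>)"
    "integrable \<Omega> (\<lambda>\<omega>. A i \<omega> * K \<omega>)" "integrable \<Omega> (\<lambda>\<omega>. A i \<omega> * A j \<omega>)" for i j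
    unfolding A_def K_def power2_eq_square
    by (intro integrable_times_last_aisle integrable_times_farthest integrable_A integrable_M)+
  note defs = E_def A_def K_def T_def G_def G'_def
  have ET: "E T = E (\<lambda>\<omega>. M \<omega>) * E P\<^sub>0 + 2 * l * k / v * E (A i) + 2 * w\<^sub>a / v * (E K - 1)"
    if "i \<in> {1..k}" for i
    unfolding defs by (rule expectation_return_time(2)[OF that])
  have ET2: "E (\<lambda>\<omega>. (T \<omega>)\<^sup>2) =
          E (\<lambda>\<omega>. real (M \<omega>) * (real (M \<omega>) - 1)) * (E P\<^sub>0)\<^sup>2
          + E (\<lambda>\<omega>. M \<omega>) * E (\<lambda>\<omega>. (P\<^sub>0 \<omega>)\<^sup>2)
          + 4 * l\<^sup>2 / v\<^sup>2 *
              (real k * E (\<lambda>\<omega>. (A i \<omega>)\<^sup>2) + real k * (real k - 1) * E (\<lambda>\<omega>. A i \<omega> * A j \<omega>))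
          + 4 * w\<^sub>a\<^sup>2 / v\<^sup>2 * (E (\<lambda>\<omega>. (K \<omega>)\<^sup>2) - 2 * E K + 1)
          + 4 * l * k / v * E P\<^sub>0 * E (\<lambda>\<omega>. M \<omega> * A i \<omega>)
          + 4 * w\<^sub>a / v * E P\<^sub>0 * (E (\<lambda>\<omega>. M \<omega> * K \<omega>) - E (\<lambda>\<omega>. M \<omega>))
          + 8 * w\<^sub>a * l / v\<^sup>2 *
              ((\<Sum>i'=1..k. E (\<lambda>\<omega>. A i' \<omega> * K \<omega>)) - real k * E (A i))"
    if "i \<in> {1..k}" "j \<in> {1..k}" "i \<noteq> j \<or> k = 1" for i j
    unfolding defs by (rule expectation_return_time_square(2)[OF that])
  have EK: "E K = real k - (\<Sum>r=0..<k. G (r / k))"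
    "E (\<lambda>\<omega>. (K \<omega>)\<^sup>2) = (real k)\<^sup>2 - (\<Sum>r=0..<k. (2 * real r + 1) * G (r / k))"
    "E (\<lambda>\<omega>. M \<omega> * K \<omega>) = k * E (\<lambda>\<omega>. M \<omega>) - (\<Sum>r=0..<k. r / k * G' (r / k))"
    unfolding defs by (rule expectation_K_moments)+
  have EA: "E (A i) = 1 - (LBINT x:{0..1}. G (1 - 1 / k + x / k))"
    "E (\<lambda>\<omega>. (A i \<omega>)\<^sup>2) = 1 - 2 * (LBINT x:{0..1}. x * G (1 - 1 / k + x / k))"
    "E (\<lambda>\<omega>. M \<omega> * A i \<omega>) =
      E (\<lambda>\<omega>. M \<omega>) - real k + (real k - 1) * G (1 - 1 / k) + (LBINT x:{0..1}. G (1 - 1 / k + x / k))"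
    "E (\<lambda>\<omega>. A i \<omega> * K \<omega>) =
      k * E (A i) - (\<Sum>r=i..<k. G (r / k) - (LBINT x:{0..1}. G ((real r - 1 + x) / k)))"
    if i: "i \<in> {1..k}" for i
    unfolding defs by (rule expectation_A[OF i] expectation_A_square[OF i] expectation_M_A[OF i]
      expectation_farthest_times_last_aisle[OF i])+
  have EAA: "E (\<lambda>\<omega>. A i \<omega> * A j \<omega>) = 1 - 2 * (LBINT x:{0..1}. G (1 - 1 / k + x / k))
      + (LBINT x:{0..1}. (LBINT y:{0..1}. G (1 - 2 / k + (x + y) / k)))"
    if "i \<in> {1..k}" "j \<in> {1..k}" "i \<noteq> j" for i j
    unfolding defs by (rule expectation_A_A[OF that])
  have same: "E (A i) = E (A i')" "E (\<lambda>\<omega>. (A i \<omega>)\<^sup>2) = E (\<lambda>\<omega>. (A i' \<omega>)\<^sup>2)"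
    "E (\<lambda>\<omega>. M \<omega> * A i \<omega>) = E (\<lambda>\<omega>. M \<omega> * A i' \<omega>)"
    if i: "i \<in> {1..k}" and i': "i' \<in> {1..k}" for i i'
    unfolding EA(1-3)[OF i] EA(1-3)[OF i'] by (rule refl)+
  have same_pair: "E (\<lambda>\<omega>. A i \<omega> * A j \<omega>) = E (\<lambda>\<omega>. A i' \<omega> * A j' \<omega>)"
    if ij: "i \<in> {1..k}" "j \<in> {1..k}" and ij': "i' \<in> {1..k}" "j' \<in> {1..k}"
      and ne: "i \<noteq> j" and ne': "i' \<noteq> j'" for i j i' j'
    unfolding EAA[OF ij ne] EAA[OF ij' ne'] by (rule refl)
  show ?thesis
    by (intro conjI ballI impI T K A ET ET2 EK EA EAA same same_pair;
      (assumption | erule conjunct1 | erule conjunct2))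
qed

end
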